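(* Let $p$ be a prime and let $G$ be a $\mathbb{Z}_p$-module with partial decomposition bases $\mathcal{C}$ and $\mathcal{C}'$. Suppose that for some equivalence class $e$ of Ulm sequences and some natural number $n$, $\hat{w}_{\mathcal{C}}(e,G) \ge n$. Then for any $Y \in \mathcal{C}'$ there is $\tilde{Y} \in \mathcal{C}'$ such that $Y \subseteq \tilde{Y}$ and $\tilde{Y}$ contains at least $n$ elements $y$ with $U(y) \in e$.
   Context: $\mathbb{Z}_p$ denotes the integers localized at the prime $p$. Define $p^0G=G$, $p^{\beta+1}G=p(p^\beta G)$, $p^\alpha G=\bigcap_{\beta<\alpha}p^\beta G$ for limit $\alpha$; the height $|x|$ of $x \in G$ is the ordinal $\alpha$ with $x\in p^\alpha G\setminus p^{\alpha+1}G$, or the symbol $\infty$ if none exists. The Ulm sequence of $x$ is $U(x)=(|p^ix|)_{i\in\omega}$. Two Ulm sequences $(\alpha_i)$, $(\beta_i)$ are equivalent if there are positive integers $m,n$ with $\alpha_{i+n}=\beta_{i+m}$ for all $i\ge0$. A subset $X\subseteq G$ is a decomposition set if it is a linearly independent set of elements of infinite order and $|a_1x_1+\cdots+a_nx_n|=\min_i|a_ix_i|$ for all $x_i\in X$, $a_i\in\mathbb{Z}_p$. For a submodule $K$, $K^0=\{x\in G: ax\in K\text{ for some }a\ne0\}$. A partial decomposition basis for $G$ is a nonempty collection $\mathcal{C}$ of finite decomposition sets of $G$ such that for all $X\in\mathcal{C}$ and $x\in G$ there is $Y\in\mathcal{C}$ with $X\subseteq Y$ and $x\in\langle Y\rangle^0$.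 For such $\mathcal{C}$ and an equivalence class $e$ of Ulm sequences, $\hat{w}_{\mathcal{C}}(e,G)$ is the maximum $n$ such that there are $X\in\mathcal{C}$ and distinct $x_1,\dots,x_n\in X$ with $U(x_i)\in e$ for all $i$, if such a maximum exists, and $\omega$ otherwise. *)

theory Defs
  imports "HOL-Algebra.Module" "HOL-Library.Extended_Nat"
    "HOL-Computational_Algebra.Primes"
begin

section \<open>The integers localized at a prime\<close>

definition Z_loc :: "nat \<Rightarrow> rat ring" where
  "Z_loc p =
    \<lparr>carrier = {of_int a / of_int b | a b. \<not> int p dvd b},
     monoid.mult = (*), one = 1, ring.zero = 0, add = (+)\<rparr>"

lemma cring_Z_loc:
  assumes "prime p"
  shows "cring (Z_loc p)"
proof -
  have pi: "prime (int p)" using assms by simp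
  have closed: "\<exists>c d. x = of_int c / of_int d \<and> \<not> int p dvd d"
    if "x = of_int (m * b' + n * b) / of_int (b * b')" "\<not> int p dvd b" "\<not> int p dvd b'"
    for x :: rat and m n b b'
    using that pi prime_dvd_mult_iff by blast
  have add: "\<exists>c d. x + y = of_int c / of_int d \<and> \<not> int p dvd d"
    if "\<exists>a b. x = of_int a / of_int b \<and> \<not> int p dvd b"
      "\<exists>a b. y = of_int a / of_int b \<and> \<not> int p dvd b" for x y :: rat
  proof -
    from that obtain a b c d where *: "x = of_int a / of_int b" "\<not> int p dvd b"
      "y = of_int c / of_int d" "\<not> int p dvd d" by blast
    then have "b \<noteq> 0" "d \<noteq> 0" by auto
    then have "x + y = of_int (a * d + c * b) / of_int (b * d)"
      using * by (simp add: field_simps)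
    then show ?thesis using closed * by blast
  qed
  have mult: "\<exists>c d. x * y = of_int c / of_int d \<and> \<not> int p dvd d"
    if "\<exists>a b. x = of_int a / of_int b \<and> \<not> int p dvd b"
      "\<exists>a b. y = of_int a / of_int b \<and> \<not> int p dvd b" for x y :: rat
  proof -
    from that obtain a b c d where *: "x = of_int a / of_int b" "\<not> int p dvd b"
      "y = of_int c / of_int d" "\<not> int p dvd d" by blast
    then have "x * y = of_int (a * c) / of_int (b * d)" by simp
    then show ?thesis using * pi prime_dvd_mult_iff by blast
  qed
  have int: "\<exists>a b. (of_int k :: rat) = of_int a / of_int b \<and> \<not> int p dvd b" for k
  proof (intro exI conjI)
    show "(of_int k :: rat) = of_int k / of_int 1" by simp
    show "\<not> int p dvd 1" using pi not_prime_unit by blast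
  qed
  have neg: "\<exists>y. (\<exists>a b. y = of_int a / of_int b \<and> \<not> int p dvd b) \<and> y + x = 0"
    if "\<exists>a b. x = of_int a / of_int b \<and> \<not> int p dvd b" for x :: rat
    using mult[OF int[of "-1"] that] by (intro exI[of _ "- x"]) simp
  show ?thesis
  proof (rule cringI)
    show "abelian_group (Z_loc p)"
      using add int[of 0] neg
      by (intro abelian_groupI) (auto simp: Z_loc_def)
    show "comm_monoid (Z_loc p)"
    proof (rule comm_monoidI)
      show "\<one>\<^bsub>Z_loc p\<^esub> \<in> carrier (Z_loc p)"
        using int[of 1] by (simp add: Z_loc_def)
      show "x \<otimes>\<^bsub>Z_loc p\<^esub> y \<in> carrier (Z_loc p)"
        if "x \<in> carrier (Z_loc p)" "y \<in> carrier (Z_loc p)" for x y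
        using mult that by (simp add: Z_loc_def)
    qed (simp_all add: Z_loc_def)
  qed (simp add: Z_loc_def distrib_right)
qed


section \<open>Ordinals\<close>

text \<open>
  HOL has no type of all ordinals. The type below is the initial ordinal
  \<open>\<kappa>\<^sup>+\<close> for the infinite cardinal \<open>\<kappa> = \<bar>'a + nat\<bar>\<close>, i.e. its elements stand for
  the ordinals of cardinality at most \<open>\<kappa>\<close>. Lemma \<open>p_pow_stabilizes\<close> shows that this is
  long enough for the heights in every module whose carrier lies in \<open>'a\<close>.
\<close>

abbreviation ord_rel :: "('a + nat) set rel" where
  "ord_rel \<equiv> cardSuc (card_of (UNIV :: ('a + nat) set))"

lemma Card_order_ord_rel: "Card_order (ord_rel :: ('a + nat) set rel)"
  by (rule cardSuc_Card_order) (rule card_of_Card_order)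

lemma infinite_Field_ord_rel: "infinite (Field (ord_rel :: ('a + nat) set rel))"
  by (simp only: card_of_cardSuc_finite) simp

typedef 'a ordinal = "Field (ord_rel :: ('a + nat) set rel)"
proof -
  have "Field (ord_rel :: ('a + nat) set rel) \<noteq> {}"
    using infinite_Field_ord_rel by (metis finite.emptyI)
  then show "\<exists>x. x \<in> Field (ord_rel :: ('a + nat) set rel)" by blast
qed

instantiation ordinal :: (type) wellorder
begin

definition less_eq_ordinal :: "'a ordinal \<Rightarrow> 'a ordinal \<Rightarrow> bool" where
  "\<alpha> \<le> \<beta> \<longleftrightarrow> (Rep_ordinal \<alpha>, Rep_ordinal \<beta>) \<in> ord_rel"

definition less_ordinal :: "'a ordinal \<Rightarrow> 'a ordinal \<Rightarrow> bool" where
  "\<alpha> < \<beta> \<longleftrightarrow> \<alpha> \<le> \<beta> \<and> \<alpha> \<noteq> (\<beta> :: 'a ordinal)"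

instance
proof -
  let ?r = "ord_rel :: ('a + nat) set rel"
  have wo: "Well_order ?r"
    using Card_order_ord_rel card_order_on_well_order_on by blast
  then have lin: "refl_on (Field ?r) ?r" "trans ?r" "antisym ?r" "total_on (Field ?r) ?r"
    and wf: "wf (?r - Id)"
    by (auto simp: order_on_defs)
  note F = Rep_ordinal[where 'a = 'a]
  have antisym: "\<alpha> = \<beta>" if "\<alpha> \<le> \<beta>" "\<beta> \<le> \<alpha>" for \<alpha> \<beta> :: "'a ordinal"
    using that lin(3) unfolding less_eq_ordinal_def
    by (meson antisymD Rep_ordinal_inject)
  have wfo: "wf {(\<alpha>, \<beta> :: 'a ordinal). \<alpha> < \<beta>}"
    by (rule wf_subset[OF wf_inv_image[OF wf, of Rep_ordinal]])
      (auto simp: less_ordinal_def less_eq_ordinal_def inv_image_def Rep_ordinal_inject)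
  show "OFCLASS('a ordinal, wellorder_class)"
  proof
    fix \<alpha> \<beta> \<gamma> :: "'a ordinal"
    show "\<alpha> < \<beta> \<longleftrightarrow> \<alpha> \<le> \<beta> \<and> \<not> \<beta> \<le> \<alpha>"
      using antisym lin(1) F by (auto simp: less_ordinal_def less_eq_ordinal_def refl_on_def)
    show "\<alpha> \<le> \<alpha>"
      using lin(1) F by (auto simp: less_eq_ordinal_def refl_on_def)
    show "\<alpha> \<le> \<gamma>" if "\<alpha> \<le> \<beta>" "\<beta> \<le> \<gamma>"
      using that lin(2) unfolding less_eq_ordinal_def by (meson transD)
    show "\<alpha> = \<beta>" if "\<alpha> \<le> \<beta>" "\<beta> \<le> \<alpha>"
      using that antisym by blast
    show "\<alpha> \<le> \<beta> \<or> \<beta> \<le> \<alpha>"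
      using lin(1,4) F unfolding less_eq_ordinal_def total_on_def refl_on_def by metis
    show "P \<alpha>" if "\<And>\<alpha>. (\<And>\<beta>. \<beta> < \<alpha> \<Longrightarrow> P \<beta>) \<Longrightarrow> P \<alpha>" for P
      using wf_induct_rule[OF wfo, of P] that by blast
  qed
qed

end

instance ordinal :: (type) no_top
proof
  fix \<alpha> :: "'a ordinal"
  obtain b where "b \<in> Field (ord_rel :: ('a + nat) set rel)" "Rep_ordinal \<alpha> \<noteq> b"
    "(Rep_ordinal \<alpha>, b) \<in> ord_rel"
    using infinite_Card_order_limit[OF Card_order_ord_rel infinite_Field_ord_rel Rep_ordinal]
    by blast
  then have "\<alpha> < Abs_ordinal b"
    by (auto simp: less_ordinal_def less_eq_ordinal_def Abs_ordinal_inverse)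
  then show "\<exists>\<beta>. \<alpha> < \<beta>" by blast
qed

definition ord_zero :: "'a ordinal" where
  "ord_zero = (LEAST \<alpha>. True)"

definition ord_succ :: "'a ordinal \<Rightarrow> 'a ordinal" where
  "ord_succ \<alpha> = (LEAST \<beta>. \<alpha> < \<beta>)"

lemma ord_zero_le [simp]: "ord_zero \<le> \<alpha>"
  unfolding ord_zero_def by (simp add: Least_le)

lemma ord_succ_greater [simp]: "\<alpha> < ord_succ \<alpha>"
  unfolding ord_succ_def using gt_ex by (rule LeastI_ex)

lemma ord_succ_le_iff: "ord_succ \<alpha> \<le> \<beta> \<longleftrightarrow> \<alpha> < \<beta>"
  using ord_succ_greater[of \<alpha>] Least_le[of "\<lambda>\<beta>. \<alpha> < \<beta>" \<beta>]
  unfolding ord_succ_def by auto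

lemma less_ord_succ_iff: "\<alpha> < ord_succ \<beta> \<longleftrightarrow> \<alpha> \<le> \<beta>"
  using ord_succ_le_iff[of \<beta> \<alpha>] by (meson not_le)

lemma ord_succ_inject [simp]: "ord_succ \<alpha> = ord_succ \<beta> \<longleftrightarrow> \<alpha> = \<beta>"
  by (metis less_ord_succ_iff order_antisym order_refl)

lemma ord_succ_neq_zero [simp]: "ord_succ \<alpha> \<noteq> ord_zero"
  by (metis ord_succ_greater ord_zero_le not_le)

lemma not_inj_ordinal: "\<not> inj (f :: 'a ordinal \<Rightarrow> 'a)"
proof
  assume "inj f"
  let ?r = "ord_rel :: ('a + nat) set rel"
  let ?g = "\<lambda>x. Inl (f (Abs_ordinal x)) :: 'a + nat"
  have "inj_on ?g (Field ?r)"
    using \<open>inj f\<close> by (intro inj_onI) (simp add: inj_eq Abs_ordinal_inject)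
  then have "(card_of (Field ?r), card_of (UNIV :: ('a + nat) set)) \<in> ordLeq"
    using card_of_ordLeq[of "Field ?r" "UNIV :: ('a + nat) set"] by blast
  moreover have "(card_of (Field ?r), ?r) \<in> ordIso"
    by (rule card_of_Field_ordIso[OF Card_order_ord_rel])
  moreover have "(card_of (UNIV :: ('a + nat) set), ?r) \<in> ordLess"
    by (rule cardSuc_greater) (rule card_of_Card_order)
  ultimately show False
    by (meson not_ordLess_ordLeq ordIso_symmetric ordIso_ordLeq_trans)
qed


section \<open>Heights and Ulm sequences\<close>

function p_pow :: "nat \<Rightarrow> (rat, 'g, 'm) module_scheme \<Rightarrow> 'g ordinal \<Rightarrow> 'g set" where
  "p_pow p G \<alpha> =
    (if \<alpha> = ord_zero then carrier G
     else if \<exists>\<beta>. \<alpha> = ord_succ \<beta>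
       then (\<lambda>x. of_nat p \<odot>\<^bsub>G\<^esub> x) ` p_pow p G (THE \<beta>. \<alpha> = ord_succ \<beta>)
     else (\<Inter>\<beta>\<in>{..<\<alpha>}. p_pow p G \<beta>))"
  by auto
termination
  by (relation "{((p, G, \<alpha>), (p', G', \<beta>)). \<alpha> < \<beta>}")
    (auto intro!: wf_subset[OF wf_inv_image[OF wf, of "snd \<circ> snd"]] simp: inv_image_def)

declare p_pow.simps [simp del]

lemma p_pow_zero: "p_pow p G ord_zero = carrier G"
  by (simp add: p_pow.simps)

lemma p_pow_succ: "p_pow p G (ord_succ \<alpha>) = (\<lambda>x. of_nat p \<odot>\<^bsub>G\<^esub> x) ` p_pow p G \<alpha>"
  by (subst p_pow.simps) auto

lemma p_pow_limit:
  assumes "\<alpha> \<noteq> ord_zero" "\<And>\<beta>. \<alpha> \<noteq> ord_succ \<beta>"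
  shows "p_pow p G \<alpha> = (\<Inter>\<beta>\<in>{..<\<alpha>}. p_pow p G \<beta>)"
  using assms by (subst p_pow.simps) auto

lemma of_nat_in_Z_loc: "prime p \<Longrightarrow> of_nat n \<in> carrier (Z_loc p)"
proof -
  assume "prime p"
  then have "\<not> int p dvd 1" "(of_nat n :: rat) = of_int (int n) / of_int 1"
    using not_prime_unit[of "int p"] by auto
  then have "\<exists>a b. (of_nat n :: rat) = of_int a / of_int b \<and> \<not> int p dvd b" by blast
  then show ?thesis by (simp add: Z_loc_def)
qed

lemma p_pow_succ_subset:
  assumes "prime p" "Module.module (Z_loc p) G"
  shows "p_pow p G (ord_succ \<alpha>) \<subseteq> p_pow p G \<alpha>"
proof (induction \<alpha> rule: less_induct)
  case (less \<alpha>)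
  consider "\<alpha> = ord_zero" | \<beta> where "\<alpha> = ord_succ \<beta>"
    | "\<alpha> \<noteq> ord_zero" "\<And>\<beta>. \<alpha> \<noteq> ord_succ \<beta>" by blast
  then show ?case
  proof cases
    case 1
    then show ?thesis
      using Module.module.smult_closed[OF assms(2) of_nat_in_Z_loc[OF assms(1)]]
      by (auto simp: p_pow_succ p_pow_zero)
  next
    case (2 \<beta>)
    then show ?thesis
      using image_mono[OF less[of \<beta>], of "\<lambda>x. of_nat p \<odot>\<^bsub>G\<^esub> x"] by (simp add: p_pow_succ)
  next
    case 3
    then show ?thesis
      using less by (fastforce simp: p_pow_succ p_pow_limit[OF 3])
  qed
qed

lemma p_pow_antimono:
  assumes "prime p" "Module.module (Z_loc p) G" "\<beta> \<le> \<alpha>"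
  shows "p_pow p G \<alpha> \<subseteq> p_pow p G \<beta>"
  using assms(3)
proof (induction \<alpha> rule: less_induct)
  case (less \<alpha>)
  consider "\<beta> = \<alpha>" | \<gamma> where "\<beta> < \<alpha>" "\<alpha> = ord_succ \<gamma>"
    | "\<beta> < \<alpha>" "\<alpha> \<noteq> ord_zero" "\<And>\<gamma>. \<alpha> \<noteq> ord_succ \<gamma>"
    using less.prems by (metis ord_zero_le not_le order_le_less)
  then show ?case
  proof cases
    case 1
    then show ?thesis by simp
  next
    case (2 \<gamma>)
    then have "p_pow p G \<gamma> \<subseteq> p_pow p G \<beta>"
      using less.IH[of \<gamma>] by (simp add: less_ord_succ_iff)
    then show ?thesis
      using 2 p_pow_succ_subset[OF assms(1,2), of \<gamma>] by blast
  next
    case 3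
    then show ?thesis by (auto simp: p_pow_limit[OF 3(2,3)])
  qed
qed

lemma p_pow_stabilizes:
  fixes G :: "(rat, 'g, 'm) module_scheme"
  assumes "prime p" "Module.module (Z_loc p) G"
  shows "\<exists>\<alpha>. p_pow p G (ord_succ \<alpha>) = p_pow p G \<alpha>"
proof (rule ccontr)
  assume "\<not> ?thesis"
  then have "\<forall>\<alpha>. \<exists>x. x \<in> p_pow p G \<alpha> - p_pow p G (ord_succ \<alpha>)"
    using p_pow_succ_subset[OF assms] by blast
  then obtain f where f: "\<And>\<alpha>. f \<alpha> \<in> p_pow p G \<alpha> - p_pow p G (ord_succ \<alpha>)"
    by metis
  have "f \<alpha> \<noteq> f \<beta>" if "\<alpha> < \<beta>" for \<alpha> \<beta>
    using f[of \<alpha>] f[of \<beta>] p_pow_antimono[OF assms, of "ord_succ \<alpha>" \<beta>] that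
    by (auto simp: ord_succ_le_iff)
  then have "inj f" by (metis injI linorder_neqE)
  then show False using not_inj_ordinal by blast
qed

datatype 'a height = Ht "'a ordinal" | Infty

instantiation height :: (type) linorder
begin

fun less_eq_height :: "'a height \<Rightarrow> 'a height \<Rightarrow> bool" where
  "Ht \<alpha> \<le> Ht \<beta> \<longleftrightarrow> \<alpha> \<le> \<beta>"
| "Infty \<le> Ht \<beta> \<longleftrightarrow> False"
| "h \<le> Infty \<longleftrightarrow> True"

definition less_height :: "'a height \<Rightarrow> 'a height \<Rightarrow> bool" where
  "h < k \<longleftrightarrow> h \<le> k \<and> \<not> k \<le> (h :: 'a height)"

instance
proof
  fix x y z :: "'a height"
  show "x < y \<longleftrightarrow> x \<le> y \<and> \<not> y \<le> x" by (rule less_height_def)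
  show "x \<le> x" by (cases x) auto
  show "x \<le> z" if "x \<le> y" "y \<le> z" using that by (cases x; cases y; cases z) auto
  show "x = y" if "x \<le> y" "y \<le> x" using that by (cases x; cases y) auto
  show "x \<le> y \<or> y \<le> x" by (cases x; cases y) auto
qed

end

definition height :: "nat \<Rightarrow> (rat, 'g, 'm) module_scheme \<Rightarrow> 'g \<Rightarrow> 'g height" where
  "height p G x =
    (if \<exists>\<alpha>. x \<in> p_pow p G \<alpha> - p_pow p G (ord_succ \<alpha>)
     then Ht (THE \<alpha>. x \<in> p_pow p G \<alpha> - p_pow p G (ord_succ \<alpha>))
     else Infty)"

lemma height_eq_Ht_iff:
  assumes "prime p" "Module.module (Z_loc p) G"
  shows "height p G x = Ht \<alpha> \<longleftrightarrow> x \<in> p_pow p G \<alpha> - p_pow p G (ord_succ \<alpha>)"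
proof -
  have unique: "\<alpha> = \<beta>" if "x \<in> p_pow p G \<alpha> - p_pow p G (ord_succ \<alpha>)"
    "x \<in> p_pow p G \<beta> - p_pow p G (ord_succ \<beta>)" for \<alpha> \<beta>
    using that p_pow_antimono[OF assms, of "ord_succ \<alpha>" \<beta>]
      p_pow_antimono[OF assms, of "ord_succ \<beta>" \<alpha>]
    by (cases \<alpha> \<beta> rule: linorder_cases) (auto simp: ord_succ_le_iff)
  show ?thesis
  proof (cases "\<exists>\<beta>. x \<in> p_pow p G \<beta> - p_pow p G (ord_succ \<beta>)")
    case True
    then obtain \<beta> where \<beta>: "x \<in> p_pow p G \<beta> - p_pow p G (ord_succ \<beta>)" by blast
    then have "(THE \<beta>. x \<in> p_pow p G \<beta> - p_pow p G (ord_succ \<beta>)) = \<beta>"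
      using unique by (intro the_equality) blast+
    then have "height p G x = Ht \<beta>" using True by (simp add: height_def)
    then show ?thesis using \<beta> unique by auto
  next
    case False
    then show ?thesis by (auto simp: height_def)
  qed
qed

lemma Ht_le_height:
  assumes "prime p" "Module.module (Z_loc p) G" "x \<in> p_pow p G \<alpha>"
  shows "Ht \<alpha> \<le> height p G x"
proof (cases "height p G x")
  case (Ht \<beta>)
  then have "x \<notin> p_pow p G (ord_succ \<beta>)"
    using height_eq_Ht_iff[OF assms(1,2)] by blast
  then have "\<not> ord_succ \<beta> \<le> \<alpha>"
    using p_pow_antimono[OF assms(1,2)] assms(3) by blast
  then show ?thesis using Ht by (simp add: ord_succ_le_iff)
qed simp

lemma height_eq_Infty_iff:
  assumes "prime p" "Module.module (Z_loc p) G" "x \<in> carrier G"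
  shows "height p G x = Infty \<longleftrightarrow> (\<forall>\<alpha>. x \<in> p_pow p G \<alpha>)"
proof
  assume inf: "height p G x = Infty"
  have step: "x \<in> p_pow p G (ord_succ \<alpha>)" if "x \<in> p_pow p G \<alpha>" for \<alpha>
    using inf that height_eq_Ht_iff[OF assms(1,2), of x \<alpha>] by auto
  show "\<forall>\<alpha>. x \<in> p_pow p G \<alpha>"
  proof
    fix \<alpha>
    show "x \<in> p_pow p G \<alpha>"
    proof (induction \<alpha> rule: less_induct)
      case (less \<alpha>)
      consider "\<alpha> = ord_zero" | \<beta> where "\<alpha> = ord_succ \<beta>"
        | "\<alpha> \<noteq> ord_zero" "\<And>\<beta>. \<alpha> \<noteq> ord_succ \<beta>" by blast
      then show ?case
      proof cases
        case 1
        then show ?thesis using assms(3) by (simp add: p_pow_zero)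
      next
        case 2
        then show ?thesis using step less by simp
      next
        case 3
        then show ?thesis using less by (simp add: p_pow_limit)
      qed
    qed
  qed
next
  assume "\<forall>\<alpha>. x \<in> p_pow p G \<alpha>"
  then show "height p G x = Infty" by (simp add: height_def)
qed

definition ulm :: "nat \<Rightarrow> (rat, 'g, 'm) module_scheme \<Rightarrow> 'g \<Rightarrow> nat \<Rightarrow> 'g height" where
  "ulm p G x = (\<lambda>i. height p G (of_nat (p ^ i) \<odot>\<^bsub>G\<^esub> x))"

text \<open>
  Abstractly, the Ulm sequences are the sequences of ordinals and \<open>\<infinity>\<close> that increase strictly
  until they possibly reach \<open>\<infinity>\<close>; these are the sequences that occur as \<open>U(x)\<close> for an
  element \<open>x\<close> of some \<open>\<int>\<^sub>p\<close>-module. Lemma \<open>ulm_sequence_ulm\<close> covers the elements of the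
  modules considered here.
\<close>

definition ulm_sequence :: "(nat \<Rightarrow> 'g height) \<Rightarrow> bool" where
  "ulm_sequence u \<longleftrightarrow> (\<forall>i. u i < u (Suc i) \<or> u i = Infty \<and> u (Suc i) = Infty)"

lemma ulm_sequence_ulm:
  assumes p: "prime p" and G: "Module.module (Z_loc p) G" and x: "x \<in> carrier G"
  shows "ulm_sequence (ulm p G x)"
  unfolding ulm_sequence_def
proof
  fix i
  interpret G: Module.module "Z_loc p" G by (fact G)
  define y where "y = of_nat (p ^ i) \<odot>\<^bsub>G\<^esub> x"
  have y: "y \<in> carrier G"
    using x of_nat_in_Z_loc[OF p] unfolding y_def by (intro G.smult_closed)
  have "of_nat p \<odot>\<^bsub>G\<^esub> y = (of_nat p \<otimes>\<^bsub>Z_loc p\<^esub> of_nat (p ^ i)) \<odot>\<^bsub>G\<^esub> x"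
    using x of_nat_in_Z_loc[OF p] unfolding y_def by (intro G.smult_assoc1[symmetric])
  then have py: "of_nat (p ^ Suc i) \<odot>\<^bsub>G\<^esub> x = of_nat p \<odot>\<^bsub>G\<^esub> y"
    by (simp add: Z_loc_def)
  have pyc: "of_nat p \<odot>\<^bsub>G\<^esub> y \<in> carrier G"
    using y of_nat_in_Z_loc[OF p] by (intro G.smult_closed)
  have step: "of_nat p \<odot>\<^bsub>G\<^esub> y \<in> p_pow p G (ord_succ \<alpha>)" if "y \<in> p_pow p G \<alpha>" for \<alpha>
    using that by (simp add: p_pow_succ)
  have "height p G y < height p G (of_nat p \<odot>\<^bsub>G\<^esub> y) \<or>
    height p G y = Infty \<and> height p G (of_nat p \<odot>\<^bsub>G\<^esub> y) = Infty"
  proof (cases "height p G y")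
    case (Ht \<alpha>)
    then have "Ht (ord_succ \<alpha>) \<le> height p G (of_nat p \<odot>\<^bsub>G\<^esub> y)"
      using height_eq_Ht_iff[OF p G] by (intro Ht_le_height[OF p G] step) blast
    moreover have "Ht \<alpha> < Ht (ord_succ \<alpha>)"
      using ord_succ_greater[of \<alpha>] by (simp add: less_height_def not_le less_imp_le del: ord_succ_greater)
    ultimately show ?thesis using Ht by simp
  next
    case Infty
    then have "of_nat p \<odot>\<^bsub>G\<^esub> y \<in> p_pow p G \<alpha>" for \<alpha>
      using step[of \<alpha>] p_pow_succ_subset[OF p G, of \<alpha>] height_eq_Infty_iff[OF p G y] by blast
    then show ?thesis
      using Infty height_eq_Infty_iff[OF p G pyc] by blast
  qed
  then show "ulm p G x i < ulm p G x (Suc i) \<or> ulm p G x i = Infty \<and> ulm p G x (Suc i) = Infty"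
    by (simp only: ulm_def py y_def)
qed

definition ulm_equiv :: "((nat \<Rightarrow> 'g height) \<times> (nat \<Rightarrow> 'g height)) set" where
  "ulm_equiv = {(u, v). ulm_sequence u \<and> ulm_sequence v \<and>
    (\<exists>m>0. \<exists>n>0. \<forall>i. u (i + n) = v (i + m))}"

lemma equiv_ulm_equiv: "equiv (Collect ulm_sequence) ulm_equiv"
proof (rule equivI)
  show "ulm_equiv \<subseteq> Collect ulm_sequence \<times> Collect ulm_sequence"
    by (auto simp: ulm_equiv_def)
  show "refl_on (Collect ulm_sequence) ulm_equiv"
    unfolding refl_on_def ulm_equiv_def using zero_less_one by blast
  show "sym ulm_equiv"
  proof (rule symI)
    fix u v :: "nat \<Rightarrow> 'g height"
    assume "(u, v) \<in> ulm_equiv"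
    then obtain m n where "ulm_sequence u" "ulm_sequence v" "0 < m" "0 < n"
      and uv: "\<And>i. u (i + n) = v (i + m)"
      unfolding ulm_equiv_def by blast
    moreover have "\<forall>i. v (i + m) = u (i + n)" using uv by simp
    ultimately show "(v, u) \<in> ulm_equiv" unfolding ulm_equiv_def by blast
  qed
  show "trans ulm_equiv"
  proof (rule transI)
    fix u v w :: "nat \<Rightarrow> 'g height"
    assume "(u, v) \<in> ulm_equiv" "(v, w) \<in> ulm_equiv"
    then obtain m n k l where *: "ulm_sequence u" "ulm_sequence w"
      "0 < m" "0 < n" "0 < k" "0 < l"
      and uv: "\<And>i. u (i + n) = v (i + m)" and vw: "\<And>i. v (i + l) = w (i + k)"
      unfolding ulm_equiv_def by blast
    have "u (i + (n + l)) = w (i + (m + k))" for i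
    proof -
      have "u (i + (n + l)) = u ((i + l) + n)" by (simp only: ac_simps)
      also have "\<dots> = v ((i + m) + l)" unfolding uv by (simp only: ac_simps)
      also have "\<dots> = w (i + (m + k))" unfolding vw by (simp only: ac_simps)
      finally show ?thesis .
    qed
    moreover have "0 < m + k" "0 < n + l" using * by simp_all
    ultimately show "(u, w) \<in> ulm_equiv"
      using *(1,2) unfolding ulm_equiv_def by blast
  qed
qed

definition ulm_classes :: "(nat \<Rightarrow> 'g height) set set" where
  "ulm_classes = Collect ulm_sequence // ulm_equiv"


section \<open>Partial decomposition bases\<close>

definition lin_indep :: "nat \<Rightarrow> (rat, 'g, 'm) module_scheme \<Rightarrow> 'g set \<Rightarrow> bool" where
  "lin_indep p G X \<longleftrightarrow> X \<subseteq> carrier G \<and>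
    (\<forall>F a. finite F \<and> F \<subseteq> X \<and> a \<in> F \<rightarrow> carrier (Z_loc p) \<and>
      finsum G (\<lambda>x. a x \<odot>\<^bsub>G\<^esub> x) F = \<zero>\<^bsub>G\<^esub> \<longrightarrow> (\<forall>x\<in>F. a x = 0))"

definition decomposition_set :: "nat \<Rightarrow> (rat, 'g, 'm) module_scheme \<Rightarrow> 'g set \<Rightarrow> bool" where
  "decomposition_set p G X \<longleftrightarrow> lin_indep p G X \<and>
    (\<forall>x\<in>X. \<forall>n::nat. n > 0 \<longrightarrow> [n] \<cdot>\<^bsub>G\<^esub> x \<noteq> \<zero>\<^bsub>G\<^esub>) \<and>
    (\<forall>F a. finite F \<and> F \<noteq> {} \<and> F \<subseteq> X \<and> a \<in> F \<rightarrow> carrier (Z_loc p) \<longrightarrow>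
      height p G (finsum G (\<lambda>x. a x \<odot>\<^bsub>G\<^esub> x) F) = Min ((\<lambda>x. height p G (a x \<odot>\<^bsub>G\<^esub> x)) ` F))"

definition span_of :: "nat \<Rightarrow> (rat, 'g, 'm) module_scheme \<Rightarrow> 'g set \<Rightarrow> 'g set" where
  "span_of p G X = (\<lambda>H. submodule H (Z_loc p) G) hull X"

definition purification :: "nat \<Rightarrow> (rat, 'g, 'm) module_scheme \<Rightarrow> 'g set \<Rightarrow> 'g set" where
  "purification p G K =
    {x \<in> carrier G. \<exists>a\<in>carrier (Z_loc p). a \<noteq> 0 \<and> a \<odot>\<^bsub>G\<^esub> x \<in> K}"

definition partial_decomposition_basis ::
    "nat \<Rightarrow> (rat, 'g, 'm) module_scheme \<Rightarrow> 'g set set \<Rightarrow> bool" where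
  "partial_decomposition_basis p G \<C> \<longleftrightarrow> \<C> \<noteq> {} \<and>
    (\<forall>X\<in>\<C>. finite X \<and> decomposition_set p G X) \<and>
    (\<forall>X\<in>\<C>. \<forall>x\<in>carrier G. \<exists>Y\<in>\<C>. X \<subseteq> Y \<and> x \<in> purification p G (span_of p G Y))"

definition w_hat :: "nat \<Rightarrow> (rat, 'g, 'm) module_scheme \<Rightarrow> 'g set set \<Rightarrow>
    (nat \<Rightarrow> 'g height) set \<Rightarrow> enat" where
  "w_hat p G \<C> e =
    (let N = {n. \<exists>X\<in>\<C>. \<exists>S\<subseteq>X. finite S \<and> card S = n \<and> (\<forall>x\<in>S. ulm p G x \<in> e)}
     in if \<exists>n\<in>N. \<forall>m\<in>N. m \<le> n then enat (GREATEST n. n \<in> N) else \<infinity>)"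

end

theory Submission
  imports Defs
begin

text \<open>
  Move \<open>n\<close> elements \<open>x\<close> of a member of \<open>\<C>\<close> with Ulm sequences in \<open>e\<close> down to multiples \<open>p\<^sup>r x\<close> with a
  common Ulm sequence \<open>v\<close>, and enlarge \<open>Y\<close> to \<open>Y' \<in> \<C>'\<close> whose span contains further multiples of
  all of them. If \<open>Y'\<close> had fewer than \<open>n\<close> elements in \<open>e\<close>, some integer combination with coefficients
  \<open>c x\<close>, not all divisible by \<open>p\<close>, would have no components along those elements. The remaining
  components have heights at least \<open>v\<close>, with strict inequality infinitely often. If \<open>v\<close> is constantly
  \<open>\<infinity>\<close> they vanish, against linear independence. Otherwise, expanding them in some
  \<open>X' \<in> \<C>\<close> above the \<open>x\<close> and comparing heights and coefficients shows that \<open>p\<close> divides every \<open>c x\<close>.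
\<close>

section \<open>Arithmetic of the localized integers\<close>

lemma mem_Z_loc_iff:
  "x \<in> carrier (Z_loc p) \<longleftrightarrow> (\<exists>a b. x = of_int a / of_int b \<and> \<not> int p dvd b)"
  by (simp add: Z_loc_def)

lemma Z_loc_simps [simp]:
  "x \<otimes>\<^bsub>Z_loc p\<^esub> y = x * y" "x \<oplus>\<^bsub>Z_loc p\<^esub> y = x + y"
  "\<one>\<^bsub>Z_loc p\<^esub> = 1" "\<zero>\<^bsub>Z_loc p\<^esub> = 0"
  by (simp_all add: Z_loc_def)

lemma of_int_in_Z_loc: "prime p \<Longrightarrow> of_int k \<in> carrier (Z_loc p)"
  unfolding mem_Z_loc_iff
  by (intro exI[of _ k] exI[of _ 1]) (auto simp: not_prime_unit)

text \<open>The numerator is a power of \<open>p\<close> times an integer prime to \<open>p\<close>,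
  and a quotient of integers prime to \<open>p\<close> is a unit. As units preserve heights, height
  computations reduce to multiples by powers of \<open>p\<close>.\<close>

lemma Z_loc_eq_prime_power_mult_unit:
  assumes "prime p" "a \<in> carrier (Z_loc p)" "a \<noteq> 0"
  obtains t u where "u \<in> carrier (Z_loc p)" "inverse u \<in> carrier (Z_loc p)" "u \<noteq> 0"
    "a = of_nat p ^ t * u"
proof -
  obtain c b where cb: "a = of_int c / of_int b" "\<not> int p dvd b"
    using assms(2) by (auto simp: mem_Z_loc_iff)
  then have "c \<noteq> 0" "b \<noteq> 0" using assms(3) by auto
  have "\<not> is_unit (int p)" using prime_gt_1_nat[OF assms(1)] by simp
  with \<open>c \<noteq> 0\<close> obtain c' where c': "c = int p ^ multiplicity (int p) c * c'" "\<not> int p dvd c'"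
    by (rule multiplicity_decompose')
  have "of_int c' / of_int b \<in> carrier (Z_loc p)"
    using cb(2) unfolding mem_Z_loc_iff by blast
  moreover have "inverse (of_int c' / of_int b) \<in> carrier (Z_loc p)"
    using c'(2) unfolding mem_Z_loc_iff inverse_divide by blast
  moreover have "of_int c' / of_int b \<noteq> (0::rat)"
    using \<open>c \<noteq> 0\<close> \<open>b \<noteq> 0\<close> c'(1) by auto
  moreover have "of_int c = (of_nat p ^ multiplicity (int p) c * of_int c' :: rat)"
    by (subst c'(1)) simp
  then have "a = of_nat p ^ multiplicity (int p) c * (of_int c' / of_int b)"
    using cb(1) by simp
  ultimately show ?thesis using that by blast
qed

text \<open>Clearing the denominator of \<open>q\<close>, which is prime to \<open>p\<close>, leaves
  an integer equation to which Euclid's lemma applies.\<close>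

lemma prime_dvd_of_Z_loc_multiple:
  assumes "prime p" "q \<in> carrier (Z_loc p)" "of_int c = of_nat p * q"
  shows "int p dvd c"
proof -
  obtain a b where ab: "q = of_int a / of_int b" "\<not> int p dvd b"
    using assms(2) by (auto simp: mem_Z_loc_iff)
  then have "b \<noteq> 0" by auto
  then have "(of_int (c * b) :: rat) = of_int (int p * a)"
    using assms(3) ab(1) by (simp add: field_simps)
  then have "c * b = int p * a" by (simp only: of_int_eq_iff)
  then have "int p dvd c * b" by simp
  then show ?thesis using ab(2) assms(1) prime_dvd_mult_iff[of "int p"] by simp
qed

section \<open>Linear relations with coprime integer coefficients\<close>

text \<open>Gaussian elimination, by induction on the set \<open>T\<close> of equations.
  \<open>S\<close> and \<open>a\<close> stay general, because a pivot removes one unknown and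
  changes the coefficients.\<close>

lemma linear_relation_rat:
  fixes a :: "'x \<Rightarrow> 'y \<Rightarrow> rat"
  assumes "finite T" "finite S" "card T < card S"
  shows "\<exists>c. (\<exists>x\<in>S. c x \<noteq> 0) \<and> (\<forall>y\<in>T. (\<Sum>x\<in>S. c x * a x y) = 0)"
  using assms
proof (induction T arbitrary: S a rule: finite_induct)
  case empty
  then have "S \<noteq> {}" by auto
  then show ?case by (intro exI[of _ "\<lambda>_. 1"]) auto
next
  case (insert t T)
  show ?case
  proof (cases "\<forall>x\<in>S. a x t = 0")
    case True
    have "card T < card S" using insert.prems insert.hyps by simp
    from insert.IH[OF insert.prems(1) this, of a] obtain c
      where "\<exists>x\<in>S. c x \<noteq> 0" "\<forall>y\<in>T. (\<Sum>x\<in>S. c x * a x y) = 0" by blast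
    then show ?thesis using True by (intro exI[of _ c]) auto
  next
    case False
    then obtain x0 where x0: "x0 \<in> S" "a x0 t \<noteq> 0" by blast
    \<comment> \<open>The pivot \<open>x0\<close> eliminates equation \<open>t\<close>: row
      \<open>x\<close> loses the multiple of row \<open>x0\<close> that makes its entry at
      \<open>t\<close> zero.\<close>
    define a' where "a' x y = a x y - a x t / a x0 t * a x0 y" for x y
    have "card T < card (S - {x0})"
      using insert.prems insert.hyps x0 by simp
    from insert.IH[OF _ this, of a'] insert.prems(1) obtain c
      where c: "\<exists>x\<in>S - {x0}. c x \<noteq> 0" "\<And>y. y \<in> T \<Longrightarrow> (\<Sum>x\<in>S - {x0}. c x * a' x y) = 0"
      by auto
    \<comment> \<open>Back substitution: the coefficient at the pivot is the one that makes equation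
      \<open>t\<close> hold.\<close>
    define d where "d = c(x0 := - (\<Sum>x\<in>S - {x0}. c x * a x t) / a x0 t)"
    have d: "(\<Sum>x\<in>S. d x * a x y) =
      (\<Sum>x\<in>S - {x0}. c x * a x y) - (\<Sum>x\<in>S - {x0}. c x * a x t) / a x0 t * a x0 y" for y
    proof -
      have "(\<Sum>x\<in>S. d x * a x y) = d x0 * a x0 y + (\<Sum>x\<in>S - {x0}. d x * a x y)"
        using insert.prems(1) x0(1) by (rule sum.remove)
      also have "(\<Sum>x\<in>S - {x0}. d x * a x y) = (\<Sum>x\<in>S - {x0}. c x * a x y)"
        by (rule sum.cong) (auto simp: d_def)
      finally show ?thesis by (simp add: d_def)
    qed
    have d': "(\<Sum>x\<in>S. d x * a x y) = (\<Sum>x\<in>S - {x0}. c x * a' x y)" for y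
      unfolding d a'_def
      by (simp add: right_diff_distrib sum_subtractf sum_distrib_right sum_divide_distrib mult.assoc)
    have "(\<Sum>x\<in>S. d x * a x t) = 0"
      unfolding d using x0(2) by simp
    moreover have "\<exists>x\<in>S. d x \<noteq> 0"
      using c(1) by (auto simp: d_def)
    ultimately show ?thesis using c(2) d' by (intro exI[of _ d]) auto
  qed
qed

lemma rat_common_denominator:
  fixes c :: "'x \<Rightarrow> rat"
  assumes "finite S"
  shows "\<exists>D::int. D \<noteq> 0 \<and> (\<forall>x\<in>S. \<exists>k. of_int D * c x = of_int k)"
  using assms
proof (induction S rule: finite_induct)
  case empty
  then show ?case by (intro exI[of _ 1]) simp
next
  case (insert x S)
  then obtain D where D: "D \<noteq> 0" "\<forall>x\<in>S. \<exists>k. of_int D * c x = of_int k" by blast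
  obtain m n where mn: "c x = of_int m / of_int n" "n \<noteq> 0"
    by (cases "c x") (auto simp: Fract_of_int_quotient)
  have "\<exists>k. of_int (D * n) * c z = of_int k" if "z \<in> insert x S" for z
  proof (cases "z = x")
    case True
    have "of_int (D * n) * c z = of_int (D * m)" unfolding True mn(1) using mn(2) by simp
    then show ?thesis by blast
  next
    case False
    then have "z \<in> S" using that by simp
    then obtain k where "of_int D * c z = of_int k" using D(2) by metis
    then have "of_int n * (of_int D * c z) = of_int (n * k)" by simp
    then have "of_int (D * n) * c z = of_int (n * k)" by (simp only: of_int_mult mult_ac)
    then show ?thesis by blast
  qed
  then show ?case using D(1) mn(2) by (intro exI[of _ "D * n"]) simp
qed

text \<open>A rational solution is multiplied by a common denominator and divided by the gcd of the
  resulting integers, so that no prime divides all of its coefficients.\<close>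

lemma linear_relation_int:
  fixes a :: "'x \<Rightarrow> 'y \<Rightarrow> rat"
  assumes "prime p" "finite T" "finite S" "card T < card S"
  shows "\<exists>c :: 'x \<Rightarrow> int. (\<exists>x\<in>S. \<not> int p dvd c x) \<and>
    (\<forall>y\<in>T. (\<Sum>x\<in>S. of_int (c x) * a x y) = 0)"
proof -
  obtain c where c: "\<exists>x\<in>S. c x \<noteq> 0" "\<And>y. y \<in> T \<Longrightarrow> (\<Sum>x\<in>S. c x * a x y) = 0"
    using linear_relation_rat[OF assms(2-4), of a] by blast
  obtain D :: int where D: "D \<noteq> 0" "\<forall>x\<in>S. \<exists>k. of_int D * c x = of_int k"
    using rat_common_denominator[OF assms(3)] by blast
  then obtain k where k: "\<And>x. x \<in> S \<Longrightarrow> of_int D * c x = of_int (k x)" by metis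
  define g where "g = Gcd (k ` S)"
  define c' where "c' x = k x div g" for x
  have kc': "k x = g * c' x" if "x \<in> S" for x
    using that by (simp add: c'_def g_def)
  have "\<exists>x\<in>S. k x \<noteq> 0"
    using c(1) D(1) k by (metis mult_eq_0_iff of_int_eq_0_iff)
  then have g: "g \<noteq> 0" by (auto simp: g_def Gcd_0_iff)
  \<comment> \<open>If \<open>p\<close> divided every quotient, then \<open>p * g\<close> would
    divide every \<open>k x\<close> and hence their gcd \<open>g\<close>.\<close>
  have "\<exists>x\<in>S. \<not> int p dvd c' x"
  proof (rule ccontr)
    assume "\<not> ?thesis"
    then have "int p * g dvd k x" if "x \<in> S" for x
      using kc'[OF that] that by (simp add: mult.commute)
    then have "int p * g dvd g" unfolding g_def by (intro Gcd_greatest) auto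
    then have "int p dvd 1" using g dvd_times_right_cancel_iff[of g "int p" 1] by simp
    then show False using prime_gt_1_nat[OF assms(1)] by simp
  qed
  moreover have "(\<Sum>x\<in>S. of_int (c' x) * a x y) = 0" if "y \<in> T" for y
  proof -
    have "of_int g * (\<Sum>x\<in>S. of_int (c' x) * a x y) = (\<Sum>x\<in>S. of_int (k x) * a x y)"
      by (simp add: sum_distrib_left kc' mult_ac)
    also have "\<dots> = of_int D * (\<Sum>x\<in>S. c x * a x y)"
      by (simp add: sum_distrib_left k[symmetric] mult_ac)
    finally show ?thesis using c(2)[OF that] g by simp
  qed
  ultimately show ?thesis by blast
qed

section \<open>Heights and linear combinations\<close>

locale Z_loc_module = Module.module "Z_loc p" G
  for p :: nat and G :: "(rat, 'g, 'm) module_scheme" (structure) +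
  assumes prime_p: "prime p"
begin

abbreviation lincomb :: "'g set \<Rightarrow> ('g \<Rightarrow> rat) \<Rightarrow> 'g" where
  "lincomb X a \<equiv> \<Oplus>x\<in>X. a x \<odot> x"

lemma module_G: "Module.module (Z_loc p) G"
  by (rule module_axioms)

lemma Zp_closed [simp, intro]:
  "a \<in> carrier (Z_loc p) \<Longrightarrow> b \<in> carrier (Z_loc p) \<Longrightarrow> a + b \<in> carrier (Z_loc p)"
  "a \<in> carrier (Z_loc p) \<Longrightarrow> b \<in> carrier (Z_loc p) \<Longrightarrow> a * b \<in> carrier (Z_loc p)"
  "0 \<in> carrier (Z_loc p)"
  "1 \<in> carrier (Z_loc p)"
  "of_nat n \<in> carrier (Z_loc p)"
  "of_int k \<in> carrier (Z_loc p)"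
  using R.a_closed[of a b] R.m_closed[of a b] R.zero_closed R.one_closed
    of_nat_in_Z_loc[OF prime_p] of_int_in_Z_loc[OF prime_p] by simp_all

lemma Zp_power [simp, intro]: "a \<in> carrier (Z_loc p) \<Longrightarrow> a ^ n \<in> carrier (Z_loc p)"
  by (induction n) simp_all

lemma Zp_sum [intro]:
  "(\<And>x. x \<in> S \<Longrightarrow> f x \<in> carrier (Z_loc p)) \<Longrightarrow> (\<Sum>x\<in>S. f x) \<in> carrier (Z_loc p)"
  by (induction S rule: infinite_finite_induct) simp_all

lemma smult_mult:
  "a \<in> carrier (Z_loc p) \<Longrightarrow> b \<in> carrier (Z_loc p) \<Longrightarrow> x \<in> carrier G \<Longrightarrow>
    a \<odot> (b \<odot> x) = (a * b) \<odot> x"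
  using smult_assoc1[of a b x] by simp

lemma smult_add:
  "a \<in> carrier (Z_loc p) \<Longrightarrow> b \<in> carrier (Z_loc p) \<Longrightarrow> x \<in> carrier G \<Longrightarrow>
    (a + b) \<odot> x = a \<odot> x \<oplus> b \<odot> x"
  using smult_l_distr[of a b x] by simp

lemma smult_0 [simp]: "x \<in> carrier G \<Longrightarrow> 0 \<odot> x = \<zero>"
  using smult_l_null[of x] by simp

lemma smult_1 [simp]: "x \<in> carrier G \<Longrightarrow> 1 \<odot> x = x"
  using smult_one[of x] by simp

section \<open>Calculus of linear combinations\<close>

lemma lincomb_closed [intro]:
  "X \<subseteq> carrier G \<Longrightarrow> (\<And>x. x \<in> X \<Longrightarrow> a x \<in> carrier (Z_loc p)) \<Longrightarrow> lincomb X a \<in> carrier G"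
  by (intro M.finsum_closed) (auto intro!: smult_closed)

lemma lincomb_smult:
  assumes "finite X" "X \<subseteq> carrier G" "\<And>x. x \<in> X \<Longrightarrow> a x \<in> carrier (Z_loc p)"
    "c \<in> carrier (Z_loc p)"
  shows "c \<odot> lincomb X a = lincomb X (\<lambda>x. c * a x)"
proof -
  have "c \<odot> lincomb X a = (\<Oplus>x\<in>X. c \<odot> (a x \<odot> x))"
    using assms by (intro finsum_smult_ldistr) (auto intro!: smult_closed)
  also have "\<dots> = lincomb X (\<lambda>x. c * a x)"
    using assms by (intro M.finsum_cong') (auto simp: smult_mult subset_iff intro!: smult_closed)
  finally show ?thesis .
qed

lemma lincomb_add:
  assumes "X \<subseteq> carrier G" "\<And>x. x \<in> X \<Longrightarrow> a x \<in> carrier (Z_loc p)"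
    "\<And>x. x \<in> X \<Longrightarrow> b x \<in> carrier (Z_loc p)"
  shows "lincomb X a \<oplus> lincomb X b = lincomb X (\<lambda>x. a x + b x)"
proof -
  have "lincomb X a \<oplus> lincomb X b = (\<Oplus>x\<in>X. a x \<odot> x \<oplus> b x \<odot> x)"
    using assms by (intro M.finsum_addf[symmetric]) (auto intro!: smult_closed)
  also have "\<dots> = lincomb X (\<lambda>x. a x + b x)"
    using assms by (intro M.finsum_cong') (auto simp: smult_add subset_iff intro!: smult_closed)
  finally show ?thesis .
qed

lemma lincomb_0 [simp]: "X \<subseteq> carrier G \<Longrightarrow> lincomb X (\<lambda>x. 0) = \<zero>"
  by (intro trans[OF M.finsum_cong' M.finsum_zero]) auto

text \<open>Padding with zero coefficients makes combinations over \<open>S\<close> comparable with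
  expansions over a larger set.\<close>

lemma lincomb_subset:
  assumes "finite X" "S \<subseteq> X" "X \<subseteq> carrier G" "\<And>x. x \<in> S \<Longrightarrow> a x \<in> carrier (Z_loc p)"
  shows "lincomb S a = lincomb X (\<lambda>x. if x \<in> S then a x else 0)"
proof -
  let ?f = "\<lambda>x. (if x \<in> S then a x else 0) \<odot> x"
  have X: "X = S \<union> (X - S)" using assms(2) by blast
  have fS: "finsum G ?f S = lincomb S a"
    using assms by (intro M.finsum_cong') (auto intro!: smult_closed)
  have f0: "finsum G ?f (X - S) = \<zero>"
    using assms by (intro trans[OF M.finsum_cong' M.finsum_zero]) auto
  have "finsum G ?f (S \<union> (X - S)) = finsum G ?f S \<oplus> finsum G ?f (X - S)"
    using assms by (intro M.finsum_Un_disjoint) (auto intro!: smult_closed intro: finite_subset)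
  then show ?thesis
    using assms fS f0 X lincomb_closed[of S a] by (auto simp: subset_iff)
qed

lemma lincomb_singleton:
  "x \<in> carrier G \<Longrightarrow> a x \<in> carrier (Z_loc p) \<Longrightarrow> lincomb {x} a = a x \<odot> x"
  by (simp add: smult_closed)

lemma lincomb_delta:
  assumes "finite X" "X \<subseteq> carrier G" "x \<in> X"
  shows "lincomb X (\<lambda>z. if z = x then 1 else 0) = x"
proof -
  have "lincomb {x} (\<lambda>_. 1) = lincomb X (\<lambda>z. if z \<in> {x} then 1 else 0)"
    using assms by (intro lincomb_subset) auto
  moreover have "lincomb {x} (\<lambda>_. 1) = x"
    using assms by (auto simp: lincomb_singleton subset_iff)
  ultimately show ?thesis by simp
qed

text \<open>Substituting expansions into a combination multiplies the coefficient matrices; by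
  induction on \<open>S\<close>.\<close>

lemma lincomb_lincomb:
  assumes "finite S" "finite X" "X \<subseteq> carrier G"
    and "\<And>z. z \<in> S \<Longrightarrow> c z \<in> carrier (Z_loc p)"
    and "\<And>z x. z \<in> S \<Longrightarrow> x \<in> X \<Longrightarrow> b z x \<in> carrier (Z_loc p)"
  shows "(\<Oplus>z\<in>S. c z \<odot> lincomb X (b z)) = lincomb X (\<lambda>x. \<Sum>z\<in>S. c z * b z x)"
  using assms(1,4,5)
proof (induction S rule: finite_induct)
  case empty
  then show ?case using assms(3) by simp
next
  case (insert w S)
  have "(\<Oplus>z\<in>insert w S. c z \<odot> lincomb X (b z)) =
      c w \<odot> lincomb X (b w) \<oplus> (\<Oplus>z\<in>S. c z \<odot> lincomb X (b z))"
    using insert.hyps insert.prems assms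
    by (intro M.finsum_insert) (auto intro!: smult_closed lincomb_closed)
  also have "c w \<odot> lincomb X (b w) = lincomb X (\<lambda>x. c w * b w x)"
    using insert.prems assms by (intro lincomb_smult) auto
  also have "(\<Oplus>z\<in>S. c z \<odot> lincomb X (b z)) = lincomb X (\<lambda>x. \<Sum>z\<in>S. c z * b z x)"
    using insert.prems by (intro insert.IH) auto
  also have "lincomb X (\<lambda>x. c w * b w x) \<oplus> lincomb X (\<lambda>x. \<Sum>z\<in>S. c z * b z x) =
      lincomb X (\<lambda>x. c w * b w x + (\<Sum>z\<in>S. c z * b z x))"
    using insert.prems assms by (intro lincomb_add) auto
  also have "\<dots> = lincomb X (\<lambda>x. \<Sum>z\<in>insert w S. c z * b z x)"
    using insert.hyps by simp
  finally show ?case .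
qed

text \<open>Subtracting the two combinations gives a relation with value zero. Negation is written
  as the scalar \<open>-1\<close> so that the difference is again a \<open>lincomb\<close>.\<close>

lemma lin_indep_eqD:
  assumes "lin_indep p G X" "finite X"
    and a: "\<And>x. x \<in> X \<Longrightarrow> a x \<in> carrier (Z_loc p)"
    and b: "\<And>x. x \<in> X \<Longrightarrow> b x \<in> carrier (Z_loc p)"
    and eq: "lincomb X a = lincomb X b" and "x \<in> X"
  shows "a x = b x"
proof -
  have X: "X \<subseteq> carrier G" using assms(1) by (simp add: lin_indep_def)
  have b': "-1 * b x \<in> carrier (Z_loc p)" if "x \<in> X" for x
    using Zp_closed(2)[OF Zp_closed(6)[of "-1"] b[OF that]] by simp
  have "lincomb X (\<lambda>x. a x + -1 * b x) = lincomb X a \<oplus> lincomb X (\<lambda>x. -1 * b x)"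
    using X a b' by (intro lincomb_add[symmetric]) auto
  also have "\<dots> = lincomb X b \<oplus> lincomb X (\<lambda>x. -1 * b x)"
    by (simp only: eq)
  also have "\<dots> = lincomb X (\<lambda>x. b x + -1 * b x)"
    using X b b' by (intro lincomb_add) auto
  also have "\<dots> = \<zero>" using X by simp
  finally have "lincomb X (\<lambda>x. a x + -1 * b x) = \<zero>" .
  moreover have "(\<lambda>x. a x + -1 * b x) \<in> X \<rightarrow> carrier (Z_loc p)"
    using a b' by blast
  ultimately have "a x + -1 * b x = 0"
    using assms(1,2,6) unfolding lin_indep_def by blast
  then show ?thesis by simp
qed

section \<open>The height filtration by submodules\<close>

lemma p_pow_closed:
  shows p_pow_subset: "p_pow p G \<alpha> \<subseteq> carrier G"
    and p_pow_zero_mem: "\<zero> \<in> p_pow p G \<alpha>"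
    and p_pow_add: "x \<in> p_pow p G \<alpha> \<Longrightarrow> y \<in> p_pow p G \<alpha> \<Longrightarrow> x \<oplus> y \<in> p_pow p G \<alpha>"
    and p_pow_smult: "a \<in> carrier (Z_loc p) \<Longrightarrow> x \<in> p_pow p G \<alpha> \<Longrightarrow> a \<odot> x \<in> p_pow p G \<alpha>"
proof -
  \<comment> \<open>One transfinite induction proves all four properties, since the successor step
    for sums and multiples also needs the inclusion in the carrier.\<close>
  have "p_pow p G \<alpha> \<subseteq> carrier G \<and> \<zero> \<in> p_pow p G \<alpha> \<and>
    (\<forall>x\<in>p_pow p G \<alpha>. \<forall>y\<in>p_pow p G \<alpha>. x \<oplus> y \<in> p_pow p G \<alpha>) \<and>
    (\<forall>a\<in>carrier (Z_loc p). \<forall>x\<in>p_pow p G \<alpha>. a \<odot> x \<in> p_pow p G \<alpha>)"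
  proof (induction \<alpha> rule: less_induct)
    case (less \<alpha>)
    consider "\<alpha> = ord_zero" | \<beta> where "\<alpha> = ord_succ \<beta>"
      | "\<alpha> \<noteq> ord_zero" "\<And>\<beta>. \<alpha> \<noteq> ord_succ \<beta>" by blast
    then show ?case
    proof cases
      case 1
      then show ?thesis by (auto simp: p_pow_zero intro: smult_closed)
    next
      case (2 \<beta>)
      let ?P = "p_pow p G \<beta>"
      have IH: "?P \<subseteq> carrier G" "\<zero> \<in> ?P" "\<And>x y. x \<in> ?P \<Longrightarrow> y \<in> ?P \<Longrightarrow> x \<oplus> y \<in> ?P"
        "\<And>a x. a \<in> carrier (Z_loc p) \<Longrightarrow> x \<in> ?P \<Longrightarrow> a \<odot> x \<in> ?P"
        using less[of \<beta>] 2 by auto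
      have "\<zero> = of_nat p \<odot> \<zero>" by simp
      then have "\<zero> \<in> (\<lambda>x. of_nat p \<odot> x) ` ?P" using IH(2) by (rule image_eqI)
      moreover have "of_nat p \<odot> x \<oplus> of_nat p \<odot> y \<in> (\<lambda>x. of_nat p \<odot> x) ` ?P"
        if "x \<in> ?P" "y \<in> ?P" for x y
        using that IH(1,3) smult_r_distr[of "of_nat p" x y]
        by (intro image_eqI[of _ _ "x \<oplus> y"]) (auto simp: subset_iff)
      moreover have "a \<odot> (of_nat p \<odot> x) \<in> (\<lambda>x. of_nat p \<odot> x) ` ?P"
        if "x \<in> ?P" "a \<in> carrier (Z_loc p)" for x a
      proof (rule image_eqI)
        show "a \<odot> (of_nat p \<odot> x) = of_nat p \<odot> (a \<odot> x)"
          using that IH(1) by (auto simp: smult_mult mult.commute subset_iff)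
      qed (use that IH(4) in blast)
      ultimately show ?thesis
        using IH(1) unfolding 2 p_pow_succ by (auto intro!: smult_closed)
    next
      case 3
      \<comment> \<open>The intersection at a limit has a term at \<open>ord_zero\<close>, which is
        the carrier; this bounds it from above.\<close>
      have "ord_zero < \<alpha>" using 3(1) by (simp add: order.strict_iff_order)
      then have "p_pow p G \<alpha> \<subseteq> carrier G"
        unfolding p_pow_limit[OF 3] using p_pow_zero[of p G] by blast
      moreover have "\<zero> \<in> p_pow p G \<beta>"
        "\<And>x y. x \<in> p_pow p G \<beta> \<Longrightarrow> y \<in> p_pow p G \<beta> \<Longrightarrow> x \<oplus> y \<in> p_pow p G \<beta>"
        "\<And>a x. a \<in> carrier (Z_loc p) \<Longrightarrow> x \<in> p_pow p G \<beta> \<Longrightarrow> a \<odot> x \<in> p_pow p G \<beta>"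
        if "\<beta> < \<alpha>" for \<beta>
        using less[OF that] by simp_all
      ultimately show ?thesis unfolding p_pow_limit[OF 3] by simp
    qed
  qed
  then show "p_pow p G \<alpha> \<subseteq> carrier G" "\<zero> \<in> p_pow p G \<alpha>"
    "x \<in> p_pow p G \<alpha> \<Longrightarrow> y \<in> p_pow p G \<alpha> \<Longrightarrow> x \<oplus> y \<in> p_pow p G \<alpha>"
    "a \<in> carrier (Z_loc p) \<Longrightarrow> x \<in> p_pow p G \<alpha> \<Longrightarrow> a \<odot> x \<in> p_pow p G \<alpha>"
    by simp_all
qed

text \<open>Translates lower bounds on heights into membership in the filtration. Quantifying over
  all \<open>\<alpha>\<close> below \<open>h\<close> lets one formula cover \<open>Infty\<close> as
  well.\<close>

lemma le_height_iff:
  assumes "x \<in> carrier G"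
  shows "h \<le> height p G x \<longleftrightarrow> (\<forall>\<alpha>. Ht \<alpha> \<le> h \<longrightarrow> x \<in> p_pow p G \<alpha>)"
proof -
  have ht: "Ht \<alpha> \<le> height p G x \<longleftrightarrow> x \<in> p_pow p G \<alpha>" for \<alpha>
  proof (cases "height p G x")
    case (Ht \<beta>)
    then have "x \<in> p_pow p G \<beta>" using height_eq_Ht_iff[OF prime_p module_G] by blast
    then have "x \<in> p_pow p G \<alpha>" if "\<alpha> \<le> \<beta>"
      using p_pow_antimono[OF prime_p module_G that] by blast
    then show ?thesis using Ht Ht_le_height[OF prime_p module_G, of x \<alpha>] by auto
  next
    case Infty
    then show ?thesis using height_eq_Infty_iff[OF prime_p module_G assms] by simp
  qed
  show ?thesis
  proof (cases h)
    case (Ht \<beta>)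
    have "x \<in> p_pow p G \<alpha>" if "x \<in> p_pow p G \<beta>" "\<alpha> \<le> \<beta>" for \<alpha>
      using p_pow_antimono[OF prime_p module_G that(2)] that(1) by blast
    then show ?thesis using Ht ht[of \<beta>] by auto
  next
    case Infty
    have "Infty \<le> height p G x \<longleftrightarrow> height p G x = Infty" by (cases "height p G x") auto
    then show ?thesis using Infty height_eq_Infty_iff[OF prime_p module_G assms] by simp
  qed
qed

lemma height_smult_ge:
  "a \<in> carrier (Z_loc p) \<Longrightarrow> x \<in> carrier G \<Longrightarrow> height p G x \<le> height p G (a \<odot> x)"
  using le_height_iff[of x "height p G x"] le_height_iff[of "a \<odot> x"] p_pow_smult by simp

lemma height_zero: "height p G \<zero> = Infty"
  using height_eq_Infty_iff[OF prime_p module_G, of \<zero>] p_pow_zero_mem by simp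

text \<open>Scalars never lower heights; this applies to \<open>u\<close> and to its
  inverse.\<close>

lemma height_unit_smult:
  assumes "u \<in> carrier (Z_loc p)" "inverse u \<in> carrier (Z_loc p)" "u \<noteq> 0" "x \<in> carrier G"
  shows "height p G (u \<odot> x) = height p G x"
proof (rule antisym)
  have "inverse u \<odot> (u \<odot> x) = x" using assms by (simp add: smult_mult)
  then show "height p G (u \<odot> x) \<le> height p G x"
    using height_smult_ge[of "inverse u" "u \<odot> x"] assms by simp
qed (use assms height_smult_ge in blast)

text \<open>The terms of the filtration are closed under addition, and the empty sum has height
  \<open>Infty\<close>, above every \<open>h\<close>.\<close>

lemma le_height_finsum:
  assumes "finite S" "\<And>z. z \<in> S \<Longrightarrow> f z \<in> carrier G" "\<And>z. z \<in> S \<Longrightarrow> h \<le> height p G (f z)"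
  shows "h \<le> height p G (\<Oplus>z\<in>S. f z)"
  using assms
proof (induction S rule: finite_induct)
  case empty
  then show ?case by (cases h) (simp_all add: height_zero)
next
  case (insert w S)
  have "(\<Oplus>z\<in>insert w S. f z) = f w \<oplus> (\<Oplus>z\<in>S. f z)"
    using insert by (intro M.finsum_insert) auto
  moreover have "(\<Oplus>z\<in>S. f z) \<in> carrier G" "f w \<in> carrier G"
    using insert.prems by (auto intro!: M.finsum_closed)
  ultimately show ?case
    using insert p_pow_add by (simp add: le_height_iff)
qed

text \<open>Write \<open>a\<close> as \<open>p ^ t\<close> times a unit, so that
  \<open>a \<odot> x\<close> has the height of \<open>p ^ t \<odot> x\<close>. If
  \<open>t \<le> k\<close>, then \<open>p ^ k \<odot> x\<close> would be a multiple of that element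
  and at least as high.\<close>

lemma height_less_imp_dvd:
  assumes a: "a \<in> carrier (Z_loc p)" and x: "x \<in> carrier G"
    and less: "height p G (of_nat p ^ k \<odot> x) < height p G (a \<odot> x)"
  shows "\<exists>q\<in>carrier (Z_loc p). a = of_nat p ^ Suc k * q"
proof (cases "a = 0")
  case True
  then show ?thesis by (intro bexI[of _ 0]) auto
next
  case False
  obtain t u where u: "u \<in> carrier (Z_loc p)" "inverse u \<in> carrier (Z_loc p)" "u \<noteq> 0"
    and tu: "a = of_nat p ^ t * u"
    using Z_loc_eq_prime_power_mult_unit[OF prime_p a False] .
  have "a \<odot> x = u \<odot> (of_nat p ^ t \<odot> x)"
    using u x by (simp add: tu smult_mult mult.commute)
  then have ht: "height p G (a \<odot> x) = height p G (of_nat p ^ t \<odot> x)"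
    using u x by (simp add: height_unit_smult)
  have "\<not> t \<le> k"
  proof
    assume "t \<le> k"
    then have "of_nat p ^ k \<odot> x = of_nat p ^ (k - t) \<odot> (of_nat p ^ t \<odot> x)"
      using x by (simp add: smult_mult flip: power_add)
    then have "height p G (of_nat p ^ t \<odot> x) \<le> height p G (of_nat p ^ k \<odot> x)"
      using x height_smult_ge[of "of_nat p ^ (k - t)" "of_nat p ^ t \<odot> x"] by simp
    then show False using less ht by simp
  qed
  then have "a = of_nat p ^ Suc k * (of_nat p ^ (t - Suc k) * u)"
    using tu by (simp flip: power_add power_Suc mult.assoc)
  then show ?thesis using u by blast
qed

subsection \<open>Comparison of partial decomposition bases\<close>

text \<open>The combinations form a submodule containing \<open>X\<close>, and the span is the least
  one.\<close>

lemma span_of_subset_lincombs: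
  assumes "finite X" "X \<subseteq> carrier G"
  shows "span_of p G X \<subseteq> {lincomb X a | a. a \<in> X \<rightarrow> carrier (Z_loc p)}"
  unfolding span_of_def
proof (rule hull_minimal)
  let ?L = "{lincomb X a | a. a \<in> X \<rightarrow> carrier (Z_loc p)}"
  show "X \<subseteq> ?L"
  proof
    fix x assume "x \<in> X"
    then have "x = lincomb X (\<lambda>z. if z = x then 1 else 0)"
      using lincomb_delta[OF assms] by simp
    then show "x \<in> ?L" by (intro CollectI exI conjI) auto
  qed
  have smult: "c \<odot> y \<in> ?L" if "c \<in> carrier (Z_loc p)" "y \<in> ?L" for c y
  proof -
    obtain a where a: "y = lincomb X a" "a \<in> X \<rightarrow> carrier (Z_loc p)" using \<open>y \<in> ?L\<close> by blast
    then have "c \<odot> y = lincomb X (\<lambda>x. c * a x)"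
      using that(1) assms by (auto intro!: lincomb_smult)
    then show ?thesis
      using a that(1) by (intro CollectI exI[of _ "\<lambda>x. c * a x"] conjI) auto
  qed
  show "submodule ?L (Z_loc p) G"
  proof (rule submoduleI)
    show sub: "?L \<subseteq> carrier G" using assms(2) by (auto intro!: lincomb_closed)
    show "\<zero> \<in> ?L" using lincomb_0[OF assms(2)] by (intro CollectI exI[of _ "\<lambda>_. 0"]) auto
    show "x \<oplus> y \<in> ?L" if xy: "x \<in> ?L" "y \<in> ?L" for x y
    proof -
      obtain a b where "x = lincomb X a" "a \<in> X \<rightarrow> carrier (Z_loc p)"
        "y = lincomb X b" "b \<in> X \<rightarrow> carrier (Z_loc p)" using xy by blast
      moreover from this have "x \<oplus> y = lincomb X (\<lambda>x. a x + b x)"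
        using assms by (auto intro!: lincomb_add)
      ultimately show ?thesis
        by (intro CollectI exI[of _ "\<lambda>x. a x + b x"] conjI) auto
    qed
    show "\<ominus> y \<in> ?L" if "y \<in> ?L" for y
    proof -
      have y: "y \<in> carrier G" using sub that by blast
      have m1: "-1 \<in> carrier (Z_loc p)" using Zp_closed(6)[of "-1"] by simp
      have "-1 \<odot> y \<oplus> y = \<zero>" using smult_add[OF m1 Zp_closed(4) y] y by simp
      then have "\<ominus> y = -1 \<odot> y" using y m1 by (intro M.minus_equality) auto
      then show ?thesis using smult[OF m1 that] by simp
    qed
  qed (rule smult)
qed

text \<open>The scalar that moves \<open>z\<close> into the span is a power of \<open>p\<close>
  times a unit; the inverse of the unit is absorbed into the coefficients.\<close>

lemma purification_span_expand:
  assumes "finite X" "X \<subseteq> carrier G" "z \<in> purification p G (span_of p G X)"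
  obtains k a where "a \<in> X \<rightarrow> carrier (Z_loc p)" "of_nat p ^ k \<odot> z = lincomb X a"
proof -
  obtain c where z: "z \<in> carrier G" and c: "c \<in> carrier (Z_loc p)" "c \<noteq> 0"
    "c \<odot> z \<in> span_of p G X"
    using assms(3) by (auto simp: purification_def)
  obtain b where b: "b \<in> X \<rightarrow> carrier (Z_loc p)" "c \<odot> z = lincomb X b"
    using c(3) span_of_subset_lincombs[OF assms(1,2)] by blast
  obtain t u where u: "u \<in> carrier (Z_loc p)" "inverse u \<in> carrier (Z_loc p)" "u \<noteq> 0"
    and tu: "c = of_nat p ^ t * u"
    using Z_loc_eq_prime_power_mult_unit[OF prime_p c(1,2)] .
  have "of_nat p ^ t \<odot> z = inverse u \<odot> (c \<odot> z)"
    using u z by (simp add: smult_mult tu mult.left_commute[of _ "of_nat p ^ t"])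
  also have "\<dots> = lincomb X (\<lambda>x. inverse u * b x)"
    unfolding b(2) using b(1) assms u by (intro lincomb_smult) auto
  finally show ?thesis
    using that[of "\<lambda>x. inverse u * b x" t] b(1) u by blast
qed

text \<open>The sum of the individual exponents serves for all of \<open>S\<close>; the surplus
  powers of \<open>p\<close> go into the coefficients.\<close>

lemma purification_span_expand_finite:
  assumes "finite X" "X \<subseteq> carrier G" "finite S" "S \<subseteq> purification p G (span_of p G X)"
  obtains k a where "\<forall>z\<in>S. a z \<in> X \<rightarrow> carrier (Z_loc p)"
    "\<forall>z\<in>S. of_nat p ^ k \<odot> z = lincomb X (a z)"
proof -
  have "\<forall>z\<in>S. \<exists>k a. a \<in> X \<rightarrow> carrier (Z_loc p) \<and> of_nat p ^ k \<odot> z = lincomb X a"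
    using purification_span_expand[OF assms(1,2)] assms(4) by (metis subsetD)
  then obtain k a where ka: "\<And>z. z \<in> S \<Longrightarrow> a z \<in> X \<rightarrow> carrier (Z_loc p)"
    "\<And>z. z \<in> S \<Longrightarrow> of_nat p ^ k z \<odot> z = lincomb X (a z)" by metis
  define K where "K = (\<Sum>z\<in>S. k z)"
  show ?thesis
  proof (rule that[of "\<lambda>z x. of_nat p ^ (K - k z) * a z x" K]; intro ballI)
    fix z assume z: "z \<in> S"
    then have zG: "z \<in> carrier G" using assms(4) by (auto simp: purification_def)
    have "k z \<le> K" unfolding K_def using z assms(3) by (simp add: member_le_sum)
    then have "of_nat p ^ K \<odot> z = of_nat p ^ (K - k z) \<odot> (of_nat p ^ k z \<odot> z)"
      using zG by (simp add: smult_mult flip: power_add)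
    also have "\<dots> = lincomb X (\<lambda>x. of_nat p ^ (K - k z) * a z x)"
      unfolding ka(2)[OF z] using ka(1)[OF z] assms by (intro lincomb_smult) auto
    finally show "of_nat p ^ K \<odot> z = lincomb X (\<lambda>x. of_nat p ^ (K - k z) * a z x)" .
    show "(\<lambda>x. of_nat p ^ (K - k z) * a z x) \<in> X \<rightarrow> carrier (Z_loc p)"
      using ka(1)[OF z] by auto
  qed
qed

lemma purification_span_mono:
  "X \<subseteq> Y \<Longrightarrow> purification p G (span_of p G X) \<subseteq> purification p G (span_of p G Y)"
  using hull_mono[of X Y "\<lambda>H. submodule H (Z_loc p) G"]
  by (auto simp: purification_def span_of_def)

text \<open>The definition absorbs one element at a time. Elements absorbed earlier stay absorbed,
  as the purification of the span grows with the set.\<close>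

lemma partial_decomposition_basis_absorb:
  assumes "partial_decomposition_basis p G \<C>" "X \<in> \<C>" "finite S" "S \<subseteq> carrier G"
  obtains Y where "Y \<in> \<C>" "X \<subseteq> Y" "S \<subseteq> purification p G (span_of p G Y)"
proof -
  have "\<exists>Y\<in>\<C>. X \<subseteq> Y \<and> S \<subseteq> purification p G (span_of p G Y)"
    using assms(3,4)
  proof (induction S rule: finite_induct)
    case empty
    then show ?case using assms(2) by blast
  next
    case (insert x S)
    then obtain Y where Y: "Y \<in> \<C>" "X \<subseteq> Y" "S \<subseteq> purification p G (span_of p G Y)" by blast
    obtain Z where Z: "Z \<in> \<C>" "Y \<subseteq> Z" "x \<in> purification p G (span_of p G Z)"
      using assms(1) Y(1) insert.prems unfolding partial_decomposition_basis_def by blast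
    then show ?case using Y purification_span_mono[OF Z(2)] by blast
  qed
  then show ?thesis using that by blast
qed

lemma partial_decomposition_basisD:
  assumes "partial_decomposition_basis p G \<C>" "X \<in> \<C>"
  shows "finite X" "decomposition_set p G X" "lin_indep p G X" "X \<subseteq> carrier G"
  using assms
  by (auto simp: partial_decomposition_basis_def decomposition_set_def lin_indep_def)

lemma height_lincomb_le:
  assumes "decomposition_set p G X" "finite X" "a \<in> X \<rightarrow> carrier (Z_loc p)" "x \<in> X"
  shows "height p G (lincomb X a) \<le> height p G (a x \<odot> x)"
proof -
  have "height p G (lincomb X a) = Min ((\<lambda>x. height p G (a x \<odot> x)) ` X)"
    using assms unfolding decomposition_set_def by blast
  then show ?thesis using assms by simp
qed

section \<open>Ulm sequences and their equivalence classes\<close>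

lemma ulm_eq: "ulm p G x i = height p G (of_nat p ^ i \<odot> x)"
  by (simp add: ulm_def)

lemma ulm_Infty_mono:
  assumes "x \<in> carrier G" "ulm p G x i = Infty" "i \<le> j"
  shows "ulm p G x j = Infty"
  using assms(3)
proof (induction rule: dec_induct)
  case (step k)
  then show ?case
    using ulm_sequence_ulm[OF prime_p module_G assms(1)]
    by (cases "ulm p G x (Suc k)") (auto simp: ulm_sequence_def less_height_def dest!: spec[of _ k])
qed (rule assms(2))

lemma ulm_classesD:
  assumes "e \<in> ulm_classes" "ulm p G x \<in> e" "x \<in> carrier G" "y \<in> carrier G"
    and "\<And>i. ulm p G x (i + k) = ulm p G y (i + l)"
  shows "ulm p G y \<in> e"
proof -
  \<comment> \<open>Equivalence asks for positive shifts, while \<open>k\<close> and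
    \<open>l\<close> may be zero; both are raised by one.\<close>
  have "ulm p G x (i + Suc k) = ulm p G y (i + Suc l)" for i
    using assms(5)[of "Suc i"] by simp
  then have "(ulm p G x, ulm p G y) \<in> ulm_equiv"
    using ulm_sequence_ulm[OF prime_p module_G] assms(3,4) unfolding ulm_equiv_def by blast
  then show ?thesis
    using assms(1,2) in_quotient_imp_closed[OF equiv_ulm_equiv] unfolding ulm_classes_def by metis
qed

text \<open>Every element of \<open>S\<close> is compared with one fixed \<open>z\<close>; far
  enough out, all the sequences contain the same tail of the sequence of \<open>z\<close>.\<close>

lemma ulm_common_tail:
  assumes "finite S" "S \<noteq> {}" "S \<subseteq> carrier G" "e \<in> ulm_classes" "\<And>x. x \<in> S \<Longrightarrow> ulm p G x \<in> e"
  obtains r v where "\<forall>x\<in>S. \<forall>i. ulm p G x (i + r x) = v i"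
    "(\<forall>i. v i = Infty) \<or> (\<forall>i. v i \<noteq> Infty)"
proof -
  obtain z where z: "z \<in> S" using assms(2) by blast
  have "(ulm p G x, ulm p G z) \<in> ulm_equiv" if "x \<in> S" for x
    using quotient_eq_iff[OF equiv_ulm_equiv, of e e] assms(4,5) that z
    unfolding ulm_classes_def by blast
  then have "\<forall>x\<in>S. \<exists>m n. \<forall>i. ulm p G x (i + n) = ulm p G z (i + m)"
    unfolding ulm_equiv_def by blast
  then obtain m n where mn: "\<And>x i. x \<in> S \<Longrightarrow> ulm p G x (i + n x) = ulm p G z (i + m x)" by metis
  obtain b where b: "(\<forall>i. ulm p G z (i + b) = Infty) \<or> (\<forall>i. ulm p G z i \<noteq> Infty)"
  proof (cases "\<exists>b. ulm p G z b = Infty")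
    case True
    then obtain b where "ulm p G z b = Infty" by blast
    then have "\<forall>i. ulm p G z (i + b) = Infty"
      using ulm_Infty_mono[of z b] z assms(3) by auto
    then show ?thesis using that by blast
  qed (use that in blast)
  \<comment> \<open>The tail of \<open>z\<close> from \<open>K\<close> on becomes \<open>v\<close>.
    As \<open>K\<close> is at least \<open>b\<close>, this tail is constantly or never
    \<open>Infty\<close>; as \<open>K\<close> is at least each \<open>m x\<close>, the subtraction
    \<open>K - m x\<close> is exact.\<close>
  define K where "K = b + (\<Sum>x\<in>S. m x)"
  have "m x \<le> K" if "x \<in> S" for x
    unfolding K_def using that assms(1) by (simp add: member_le_sum trans_le_add2)
  then have "i + (K - m x) + m x = i + K" if "x \<in> S" for x i using that by force
  then have "ulm p G x (i + (K - m x + n x)) = ulm p G z (i + K)" if "x \<in> S" for x i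
    using mn[OF that, of "i + (K - m x)"] that by (simp only: add.assoc)
  then have "\<forall>x\<in>S. \<forall>i. ulm p G x (i + (K - m x + n x)) = ulm p G z (i + K)" by blast
  moreover have "(\<forall>i. ulm p G z (i + K) = Infty) \<or> (\<forall>i. ulm p G z (i + K) \<noteq> Infty)"
  proof -
    have "i + K = (i + (\<Sum>x\<in>S. m x)) + b" for i by (simp add: K_def)
    then show ?thesis using b by metis
  qed
  ultimately show ?thesis by (rule that)
qed

text \<open>The counting argument for a \<open>Y\<close> that has already absorbed \<open>S\<close>.
  The expansion goes from \<open>S\<close> to \<open>Y\<close>, and then from \<open>Y\<close> back
  to a member of \<open>\<C>\<close> above \<open>X\<close>.\<close>

lemma card_le_card_ulm_class:
  assumes \<C>: "partial_decomposition_basis p G \<C>" and \<C>': "partial_decomposition_basis p G \<C>'"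
    and e: "e \<in> ulm_classes" and X: "X \<in> \<C>" and S: "S \<subseteq> X" "\<And>x. x \<in> S \<Longrightarrow> ulm p G x \<in> e"
    and Y: "Y \<in> \<C>'" and SY: "S \<subseteq> purification p G (span_of p G Y)"
  shows "card S \<le> card {y \<in> Y. ulm p G y \<in> e}"
proof (rule ccontr)
  define T where "T = {y \<in> Y. ulm p G y \<in> e}"
  assume "\<not> card S \<le> card {y \<in> Y. ulm p G y \<in> e}"
  then have card: "card T < card S" by (simp add: T_def)
  note Xp = partial_decomposition_basisD[OF \<C> X]
  note Yp = partial_decomposition_basisD[OF \<C>' Y]
  have fS: "finite S" and SG: "S \<subseteq> carrier G" using S(1) Xp finite_subset by blast+
  have fT: "finite T" and "S \<noteq> {}" using Yp(1) card by (auto simp: T_def)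
  obtain r v where rv': "\<forall>x\<in>S. \<forall>i. ulm p G x (i + r x) = v i"
    and v: "(\<forall>i. v i = Infty) \<or> (\<forall>i. v i \<noteq> Infty)"
    using ulm_common_tail[OF fS \<open>S \<noteq> {}\<close> SG e S(2)] .
  note rv = rv'[rule_format]
  obtain N a0 where a0': "\<forall>x\<in>S. a0 x \<in> Y \<rightarrow> carrier (Z_loc p)"
    "\<forall>x\<in>S. of_nat p ^ N \<odot> x = lincomb Y (a0 x)"
    using purification_span_expand_finite[OF Yp(1,4) fS SY] .
  note a0 = bspec[OF a0'(1)] bspec[OF a0'(2)]
  \<comment> \<open>The extra factor \<open>p ^ r x\<close> aligns the heights:
    \<open>p ^ (N + r x + i) \<odot> x\<close> has height \<open>v (i + N)\<close> for every
    \<open>x\<close> in \<open>S\<close>.\<close>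
  define a where "a x y = of_nat p ^ r x * a0 x y" for x y
  have a: "a x y \<in> carrier (Z_loc p)" if "x \<in> S" "y \<in> Y" for x y
    using a0(1)[OF that(1)] that(2) by (auto simp: a_def)
  have exp: "of_nat p ^ (N + r x + i) \<odot> x = lincomb Y (\<lambda>y. of_nat p ^ i * a x y)"
    if "x \<in> S" for x i
  proof -
    have "of_nat p ^ (N + r x + i) \<odot> x = of_nat p ^ (i + r x) \<odot> (of_nat p ^ N \<odot> x)"
      using that SG by (auto simp: smult_mult subset_iff ac_simps simp flip: power_add)
    also have "\<dots> = lincomb Y (\<lambda>y. of_nat p ^ (i + r x) * a0 x y)"
      unfolding a0(2)[OF that] using Yp a0(1)[OF that] by (intro lincomb_smult) auto
    finally show ?thesis by (simp add: a_def power_add mult.assoc)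
  qed
  have v_le: "v (i + N) \<le> height p G ((of_nat p ^ i * a x y) \<odot> y)" if "x \<in> S" "y \<in> Y" for x y i
  proof -
    have "v (i + N) = height p G (of_nat p ^ (N + r x + i) \<odot> x)"
      unfolding rv[OF that(1), symmetric] ulm_eq by (simp add: ac_simps)
    also have "\<dots> \<le> height p G ((of_nat p ^ i * a x y) \<odot> y)"
      unfolding exp[OF that(1)] using Yp a that by (intro height_lincomb_le) auto
    finally show ?thesis .
  qed
  obtain c :: "'g \<Rightarrow> int" where c: "\<exists>x\<in>S. \<not> int p dvd c x"
    "\<And>y. y \<in> T \<Longrightarrow> (\<Sum>x\<in>S. of_int (c x) * a x y) = 0"
    using linear_relation_int[OF prime_p fT fS card, of a] by blast
  \<comment> \<open>These are the coefficients over \<open>Y\<close> of the sum of all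
    \<open>c x * p ^ (N + r x)\<close> times \<open>x\<close>. By the choice of \<open>c\<close>
    they vanish on \<open>T\<close>.\<close>
  define d where "d y = (\<Sum>x\<in>S. of_int (c x) * a x y)" for y
  have d: "d y \<in> carrier (Z_loc p)" if "y \<in> Y" for y
    unfolding d_def using a that by (intro Zp_sum) auto
  have dT: "d y = 0" if "y \<in> T" for y
    using c(2)[OF that] by (simp add: d_def)
  have v_le_d: "v (i + N) \<le> height p G ((of_nat p ^ i * d y) \<odot> y)" if y: "y \<in> Y" for y i
  proof -
    let ?f = "\<lambda>x. of_int (c x) \<odot> ((of_nat p ^ i * a x y) \<odot> y)"
    have yG: "y \<in> carrier G" using y Yp(4) by blast
    \<comment> \<open>Over the singleton \<open>{y}\<close>, distributing the sum of scalars is an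
      instance of \<open>lincomb_lincomb\<close>.\<close>
    have "(of_nat p ^ i * d y) \<odot> y = lincomb {y} (\<lambda>y. \<Sum>x\<in>S. of_int (c x) * (of_nat p ^ i * a x y))"
      using yG a[OF _ y] unfolding d_def sum_distrib_left
      by (subst lincomb_singleton) (auto intro!: Zp_sum simp: ac_simps)
    also have "\<dots> = (\<Oplus>x\<in>S. of_int (c x) \<odot> lincomb {y} (\<lambda>y. of_nat p ^ i * a x y))"
      using yG fS a y by (intro lincomb_lincomb[symmetric]) auto
    also have "\<dots> = (\<Oplus>x\<in>S. ?f x)"
      using yG a[OF _ y] by (intro M.finsum_cong') (auto intro!: smult_closed)
    finally have eq: "(of_nat p ^ i * d y) \<odot> y = (\<Oplus>x\<in>S. ?f x)" .
    have "v (i + N) \<le> height p G (?f x)" if "x \<in> S" for x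
    proof (rule order_trans[OF v_le[OF that y]])
      show "height p G ((of_nat p ^ i * a x y) \<odot> y) \<le> height p G (?f x)"
        using a[OF that y] yG by (intro height_smult_ge) (auto intro!: smult_closed)
    qed
    then show ?thesis
      unfolding eq using fS a[OF _ y] yG by (intro le_height_finsum) (auto intro!: smult_closed)
  qed
  \<comment> \<open>With \<open>d y\<close> equal to \<open>p ^ t\<close> times a unit, equality
    from \<open>M\<close> on would make a tail of the Ulm sequence of \<open>y\<close> a tail of
    \<open>v\<close>. Then \<open>y\<close> lies in \<open>T\<close>, where \<open>d\<close>
    vanishes.\<close>
  have d_zero: "d y = 0"
    if y: "y \<in> Y" and eq: "\<And>i. v (i + M + N) = height p G ((of_nat p ^ (i + M) * d y) \<odot> y)" for y M
  proof (rule ccontr)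
    assume "d y \<noteq> 0"
    have yG: "y \<in> carrier G" using y Yp(4) by blast
    obtain t u where u: "u \<in> carrier (Z_loc p)" "inverse u \<in> carrier (Z_loc p)" "u \<noteq> 0"
      and tu: "d y = of_nat p ^ t * u"
      using Z_loc_eq_prime_power_mult_unit[OF prime_p d[OF y] \<open>d y \<noteq> 0\<close>] .
    obtain x where x: "x \<in> S" using \<open>S \<noteq> {}\<close> by blast
    have "ulm p G x (i + (M + N + r x)) = ulm p G y (i + (M + t))" for i
    proof -
      have "(of_nat p ^ (i + M) * d y) \<odot> y = u \<odot> (of_nat p ^ (i + (M + t)) \<odot> y)"
        using u yG by (simp add: smult_mult tu power_add ac_simps)
      then have "height p G ((of_nat p ^ (i + M) * d y) \<odot> y) = ulm p G y (i + (M + t))"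
        using u yG by (simp add: height_unit_smult ulm_eq)
      then show ?thesis using eq[of i] rv[OF x, of "i + M + N"] by (simp add: add.assoc)
    qed
    then have "ulm p G y \<in> e"
      using ulm_classesD[OF e S(2)[OF x]] x SG yG by blast
    then show False using dT[of y] y \<open>d y \<noteq> 0\<close> by (simp add: T_def)
  qed
  \<comment> \<open>The same element in terms of \<open>S\<close>, padded by zero so that it can be
    read over both \<open>X\<close> and the later \<open>X'\<close>.\<close>
  define w where "w = (\<lambda>x. if x \<in> S then of_int (c x) * of_nat p ^ (N + r x) else 0 :: rat)"
  have w: "w x \<in> carrier (Z_loc p)" for x by (simp add: w_def)
  have wX: "lincomb Z w = lincomb Y d" if "finite Z" "S \<subseteq> Z" "Z \<subseteq> carrier G" for Z
  proof -
    have "lincomb Z w = lincomb S (\<lambda>x. of_int (c x) * of_nat p ^ (N + r x))"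
      using that unfolding w_def by (intro lincomb_subset[symmetric]) auto
    also have "\<dots> = (\<Oplus>x\<in>S. of_int (c x) \<odot> lincomb Y (a x))"
      using SG Yp a exp[of _ 0]
      by (intro M.finsum_cong') (auto simp: smult_mult[symmetric] subset_iff
          intro!: smult_closed lincomb_closed)
    also have "\<dots> = lincomb Y d"
      unfolding d_def using fS Yp a by (intro lincomb_lincomb) auto
    finally show ?thesis .
  qed
  from v show False
  proof
    assume v: "\<forall>i. v i = Infty"
    \<comment> \<open>The lower bound \<open>Infty\<close> forces equality of heights, so
      \<open>d_zero\<close> applies to every \<open>y\<close>.\<close>
    have "d y = 0" if "y \<in> Y" for y
    proof (rule d_zero[of y 0, OF that])
      show "v (i + 0 + N) = height p G ((of_nat p ^ (i + 0) * d y) \<odot> y)" for i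
        using v_le_d[OF that, of i] v by (cases "height p G ((of_nat p ^ i * d y) \<odot> y)") auto
    qed
    then have "lincomb Y d = lincomb Y (\<lambda>_. 0)"
      using Yp(4) by (intro M.finsum_cong') auto
    then have "lincomb X w = lincomb X (\<lambda>_. 0)"
      using wX[OF Xp(1) S(1) Xp(4)] Xp(4) Yp(4) by simp
    then have "w x = 0" if "x \<in> X" for x
      using lin_indep_eqD[OF Xp(3,1), of w "\<lambda>_. 0" x] w that by simp
    then have "c x = 0" if "x \<in> S" for x
      using that S(1) prime_gt_0_nat[OF prime_p] by (force simp: w_def)
    then show False using c(1) by force
  next
    assume v: "\<forall>i. v i \<noteq> Infty"
    obtain X' where X': "X' \<in> \<C>" "X \<subseteq> X'" "Y \<subseteq> purification p G (span_of p G X')"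
      using partial_decomposition_basis_absorb[OF \<C> X Yp(1,4)] .
    note X'p = partial_decomposition_basisD[OF \<C> X'(1)]
    have SX': "S \<subseteq> X'" using S(1) X'(2) by blast
    obtain M b where b0: "\<forall>y\<in>Y. b y \<in> X' \<rightarrow> carrier (Z_loc p)"
      "\<forall>y\<in>Y. of_nat p ^ M \<odot> y = lincomb X' (b y)"
      using purification_span_expand_finite[OF X'p(1,4) Yp(1) X'(3)] .
    note b = bspec[OF b0(1)] bspec[OF b0(2)]
    have b': "b y x \<in> carrier (Z_loc p)" if "y \<in> Y" "x \<in> X'" for y x
      using b(1)[OF that(1)] that(2) by blast
    \<comment> \<open>Expanding \<open>p ^ M\<close> times the element over \<open>X'\<close>, once
      directly and once through \<open>Y\<close>, makes the coefficients comparable.\<close>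
    have "lincomb X' (\<lambda>x. of_nat p ^ M * w x) = of_nat p ^ M \<odot> lincomb X' w"
      using X'p w by (intro lincomb_smult[symmetric]) auto
    also have "\<dots> = of_nat p ^ M \<odot> lincomb Y d"
      using wX[OF X'p(1) SX' X'p(4)] by simp
    also have "\<dots> = lincomb Y (\<lambda>y. of_nat p ^ M * d y)"
      using Yp d by (intro lincomb_smult) auto
    also have "\<dots> = (\<Oplus>y\<in>Y. d y \<odot> lincomb X' (b y))"
      using Yp(4) d X'p b'
      by (intro M.finsum_cong') (auto simp: b(2)[symmetric] smult_mult subset_iff mult.commute
          intro!: smult_closed lincomb_closed)
    also have "\<dots> = lincomb X' (\<lambda>x. \<Sum>y\<in>Y. d y * b y x)"
      using Yp X'p d b' by (intro lincomb_lincomb) auto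
    finally have coeff: "of_nat p ^ M * w x = (\<Sum>y\<in>Y. d y * b y x)" if "x \<in> X'" for x
      using that X'p w d b' by (intro lin_indep_eqD[OF X'p(3,1)]) (auto intro!: Zp_sum)
    \<comment> \<open>The exponent exceeds by one the power of \<open>p\<close> visible in
      \<open>p ^ M * w x\<close>; this surplus factor will divide \<open>c x\<close>.\<close>
    have dvd: "\<exists>q\<in>carrier (Z_loc p). d y * b y x = of_nat p ^ Suc (M + N + r x) * q"
      if x: "x \<in> S" and y: "y \<in> Y" for x y
    proof -
      have xX': "x \<in> X'" and xG: "x \<in> carrier G" and yG: "y \<in> carrier G"
        using x y SX' SG Yp(4) by blast+
      \<comment> \<open>Permanent equality would give \<open>d y = 0\<close> by
        \<open>d_zero\<close>, hence height \<open>Infty\<close>, a value that \<open>v\<close>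
        never takes. The shift by \<open>M\<close> is the one that makes \<open>y\<close> expandable
        over \<open>X'\<close>.\<close>
      have "\<exists>i. v (i + M + N) < height p G ((of_nat p ^ (i + M) * d y) \<odot> y)"
      proof (rule ccontr)
        assume "\<not> ?thesis"
        then have eq: "v (i + M + N) = height p G ((of_nat p ^ (i + M) * d y) \<odot> y)" for i
          using v_le_d[OF y, of "i + M"] by (metis order.not_eq_order_implies_strict)
        then have "d y = 0" by (rule d_zero[OF y])
        then show False using eq[of 0] v yG height_zero by simp
      qed
      then obtain i where i: "v (i + M + N) < height p G ((of_nat p ^ (i + M) * d y) \<odot> y)" ..
      have "(of_nat p ^ (i + M) * d y) \<odot> y = (of_nat p ^ i * d y) \<odot> lincomb X' (b y)"
        using d[OF y] yG by (simp add: b(2)[OF y, symmetric] smult_mult power_add ac_simps)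
      also have "\<dots> = lincomb X' (\<lambda>x. (of_nat p ^ i * d y) * b y x)"
        using d[OF y] X'p b'[OF y] by (intro lincomb_smult) auto
      finally have "height p G ((of_nat p ^ (i + M) * d y) \<odot> y) \<le>
          height p G ((of_nat p ^ i * d y * b y x) \<odot> x)"
        using X'p d[OF y] b'[OF y] xX' height_lincomb_le[of X' "\<lambda>x. (of_nat p ^ i * d y) * b y x" x]
        by auto
      moreover have "v (i + M + N) = height p G (of_nat p ^ (i + (M + N + r x)) \<odot> x)"
        unfolding rv[OF x, symmetric] ulm_eq by (simp add: add.assoc)
      \<comment> \<open>The component at \<open>x\<close> is now strictly higher than a power of
        \<open>p\<close> times \<open>x\<close>, which bounds the coefficient's power of
        \<open>p\<close> from below; the auxiliary factor \<open>p ^ i\<close> then cancels.\<close>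
      ultimately have "height p G (of_nat p ^ (i + (M + N + r x)) \<odot> x) <
          height p G ((of_nat p ^ i * d y * b y x) \<odot> x)" using i by simp
      then obtain q where "q \<in> carrier (Z_loc p)"
        "of_nat p ^ i * d y * b y x = of_nat p ^ Suc (i + (M + N + r x)) * q"
        using height_less_imp_dvd[of "of_nat p ^ i * d y * b y x" x] d[OF y] b'[OF y xX'] xG by blast
      moreover have "(of_nat p ^ i :: rat) \<noteq> 0" using prime_gt_0_nat[OF prime_p] by simp
      ultimately show ?thesis by (intro bexI[of _ q]) (auto simp: power_add mult_ac)
    qed
    have "int p dvd c x" if x: "x \<in> S" for x
    proof -
      obtain q where q: "\<And>y. y \<in> Y \<Longrightarrow> q y \<in> carrier (Z_loc p)"
        "\<And>y. y \<in> Y \<Longrightarrow> d y * b y x = of_nat p ^ Suc (M + N + r x) * q y"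
        using dvd[OF x] by metis
      have "of_nat p ^ (M + N + r x) * of_int (c x) = of_nat p ^ M * w x"
        using x by (simp add: w_def power_add mult_ac)
      also have "\<dots> = (\<Sum>y\<in>Y. d y * b y x)"
        using coeff x SX' by blast
      also have "\<dots> = of_nat p ^ (M + N + r x) * (of_nat p * (\<Sum>y\<in>Y. q y))"
        by (simp add: q(2) sum_distrib_left sum_distrib_right mult_ac)
      finally have "of_int (c x) = of_nat p * (\<Sum>y\<in>Y. q y)"
        using prime_gt_0_nat[OF prime_p] by simp
      then show ?thesis
        using prime_dvd_of_Z_loc_multiple[OF prime_p] q(1) Zp_sum by blast
    qed
    then show False using c(1) by blast
  qed
qed

end

text \<open>A maximum is attained, and without one the possible cardinalities are unbounded. A
  subset of the set so found has exactly \<open>n\<close> elements.\<close>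

lemma w_hat_geD:
  assumes "enat n \<le> w_hat p G \<C> e" "\<C> \<noteq> {}"
  obtains X S where "X \<in> \<C>" "S \<subseteq> X" "card S = n" "\<And>x. x \<in> S \<Longrightarrow> ulm p G x \<in> e"
proof -
  define N where "N = {n. \<exists>X\<in>\<C>. \<exists>S\<subseteq>X. finite S \<and> card S = n \<and> (\<forall>x\<in>S. ulm p G x \<in> e)}"
  have w: "w_hat p G \<C> e = (if \<exists>n\<in>N. \<forall>m\<in>N. m \<le> n then enat (GREATEST n. n \<in> N) else \<infinity>)"
    unfolding w_hat_def Let_def N_def by (rule refl)
  have "\<exists>m\<in>N. n \<le> m"
  proof (cases "\<exists>n\<in>N. \<forall>m\<in>N. m \<le> n")
    case True
    then obtain k where "k \<in> N" "\<And>m. m \<in> N \<Longrightarrow> m \<le> k" by blast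
    then have "(GREATEST n. n \<in> N) \<in> N" by (rule GreatestI_nat)
    then show ?thesis using assms(1) True w by auto
  next
    case False
    show ?thesis
    \<comment> \<open>Each possible cardinality is exceeded by another one; the empty subset of a
      member of \<open>\<C>\<close> starts the chain.\<close>
    proof (induction n)
      case 0
      have "0 \<in> N" using assms(2) by (force simp: N_def)
      then show ?case by blast
    next
      case (Suc n)
      then show ?case using False by (meson Suc_leI le_less_trans not_le)
    qed
  qed
  then obtain X S where XS: "X \<in> \<C>" "S \<subseteq> X" "n \<le> card S" "\<forall>x\<in>S. ulm p G x \<in> e"
    by (auto simp: N_def)
  then obtain S' where "S' \<subseteq> S" "card S' = n" by (metis obtain_subset_with_card_n)
  then show ?thesis using that[of X S'] XS by blast
qed

theorem theorem7:
  fixes p :: nat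
    and G :: "(rat, 'g, 'm) module_scheme"
    and \<C> \<C>' :: "'g set set"
    and e :: "(nat \<Rightarrow> 'g height) set"
    and n :: nat
    and Y :: "'g set"
  assumes "prime p"
    and "Module.module (Z_loc p) G"
    and "partial_decomposition_basis p G \<C>"
    and "partial_decomposition_basis p G \<C>'"
    and "e \<in> ulm_classes"
    and "w_hat p G \<C> e \<ge> enat n"
    and "Y \<in> \<C>'"
  shows "\<exists>Y'\<in>\<C>'. Y \<subseteq> Y' \<and> card {y \<in> Y'. ulm p G y \<in> e} \<ge> n"
proof -
  interpret Z_loc_module p G
    using assms(1,2) by (intro Z_loc_module.intro Z_loc_module_axioms.intro)
  have "\<C> \<noteq> {}" using assms(3) by (simp add: partial_decomposition_basis_def)
  then obtain X S where X: "X \<in> \<C>" "S \<subseteq> X" "card S = n" "\<And>x. x \<in> S \<Longrightarrow> ulm p G x \<in> e"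
    using w_hat_geD[OF assms(6)] by blast
  then have S: "finite S" "S \<subseteq> carrier G"
    using partial_decomposition_basisD[OF assms(3) X(1)] finite_subset by blast+
  \<comment> \<open>Absorption starts from the given \<open>Y\<close>, which secures the inclusion
    in \<open>Y'\<close>.\<close>
  obtain Y' where "Y' \<in> \<C>'" "Y \<subseteq> Y'" "S \<subseteq> purification p G (span_of p G Y')"
    using partial_decomposition_basis_absorb[OF assms(4,7) S] .
  then show ?thesis
    using card_le_card_ulm_class[OF assms(3-5) X(1,2,4)] X(3) by blast
qed

end
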